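(* Let $d\geq 2$ and $1\leq q,r\leq\infty$. There exists an absolute constant $A_0>1$ such that the following holds for every $A\geq A_0$. Suppose that there exists a constant $C>0$ such that $$\big\|e^{it|\nabla|}f\; e^{it\Delta}g\big\|_{L^q_tL^r_x(\mathbb{R}^{1+d})}\leq C\|f\|_{L^2(\mathbb{R}^d)}\|g\|_{L^2(\mathbb{R}^d)}$$ for all $f,g\in L^2(\mathbb{R}^d)$ with $\operatorname{supp}\widehat{f},\ \operatorname{supp}\widehat{g}\subset\{\xi\in\mathbb{R}^d : A^{-1}\leq|\xi|\leq A\}$. Then $$\frac{2}{q}+\frac{d-1}{r}\leq d-\frac12\qquad\text{and}\qquad \frac1q\leq\frac{d+1}{4}.$$
   Context: $\widehat{f}$ denotes the spatial Fourier transform on $\mathbb{R}^d$. The wave propagator $e^{it|\nabla|}$ and the Schrödinger propagator $e^{it\Delta}$ are the Fourier multipliers with symbols $e^{it|\xi|}$ and $e^{-it|\xi|^2}$ respectively. The norm is $\|F\|_{L^q_tL^r_x(\mathbb{R}^{1+d})}=\big\|\,\|F(t,\cdot)\|_{L^r_x(\mathbb{R}^d)}\big\|_{L^q_t(\mathbb{R})}$, with the convention $1/\infty=0$. *)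

theory Defs
  imports "HOL-Analysis.Analysis" "HOL-Probability.Essential_Supremum"
begin

text \<open>
  The dimension \<open>d\<close> has to be a variable inside the formula, because the absolute constant
  is chosen before it. Hence Euclidean \<open>d\<close>-space is modelled by functions \<open>nat \<Rightarrow> real\<close>
  restricted to the indices below \<open>d\<close>; its Euclidean norm is \<open>L2_set x {..<d}\<close>.
\<close>

definition Leb :: "nat \<Rightarrow> (nat \<Rightarrow> real) measure" where
  "Leb d = Pi\<^sub>M {..<d} (\<lambda>_. lborel)"

definition ennreal_powr :: "ennreal \<Rightarrow> real \<Rightarrow> ennreal" where
  "ennreal_powr x p = (if x = \<infinity> then \<infinity> else ennreal (enn2real x powr p))"

text \<open>Only used for exponents \<open>p > 0\<close>, for which \<open>0\<close> and \<open>\<infinity>\<close> are fixed points of the power.\<close>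

definition Lnorm :: "'a measure \<Rightarrow> ereal \<Rightarrow> ('a \<Rightarrow> ennreal) \<Rightarrow> ennreal" where
  "Lnorm M p f =
     (if p = \<infinity> then esssup M f
      else ennreal_powr (\<integral>\<^sup>+ x. ennreal_powr (f x) (real_of_ereal p) \<partial>M) (1 / real_of_ereal p))"

definition L2norm :: "nat \<Rightarrow> ((nat \<Rightarrow> real) \<Rightarrow> complex) \<Rightarrow> ennreal" where
  "L2norm d f = Lnorm (Leb d) 2 (\<lambda>x. ennreal (norm (f x)))"

definition L2 :: "nat \<Rightarrow> ((nat \<Rightarrow> real) \<Rightarrow> complex) set" where
  "L2 d = {f \<in> borel_measurable (Leb d). L2norm d f < \<infinity>}"

definition mixed_norm :: "nat \<Rightarrow> ereal \<Rightarrow> ereal \<Rightarrow> (real \<Rightarrow> (nat \<Rightarrow> real) \<Rightarrow> complex) \<Rightarrow> ennreal" where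
  "mixed_norm d q r F = Lnorm lborel q (\<lambda>t. Lnorm (Leb d) r (\<lambda>x. ennreal (norm (F t x))))"

definition fourier_L1 :: "nat \<Rightarrow> ((nat \<Rightarrow> real) \<Rightarrow> complex) \<Rightarrow> (nat \<Rightarrow> real) \<Rightarrow> complex" where
  "fourier_L1 d f \<xi> = (LINT x|Leb d. cis (- (\<Sum>i<d. x i * \<xi> i)) * f x)"

text \<open>
  The Fourier transform on \<open>L\<^sup>2\<close> is the continuous extension of the Fourier integral from
  \<open>L\<^sup>1 \<inter> L\<^sup>2\<close>. It is given through its graph: \<open>h\<close> is a representative of the transform of \<open>f\<close>.
  By Plancherel's theorem such an \<open>h\<close> exists and is unique up to null sets. With the
  phase \<open>x \<bullet> \<xi>\<close> the Laplacian has symbol \<open>- \<bar>\<xi>\<bar>\<^sup>2\<close>; a constant in front of the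
  integral would not affect Fourier multipliers or Fourier supports.
\<close>

definition has_fourier ::
    "nat \<Rightarrow> ((nat \<Rightarrow> real) \<Rightarrow> complex) \<Rightarrow> ((nat \<Rightarrow> real) \<Rightarrow> complex) \<Rightarrow> bool" where
  "has_fourier d f h \<longleftrightarrow> f \<in> L2 d \<and> h \<in> L2 d \<and>
     (\<exists>\<phi>. (\<forall>n::nat. integrable (Leb d) (\<phi> n) \<and> \<phi> n \<in> L2 d) \<and>
        (\<lambda>n. L2norm d (\<lambda>x. \<phi> n x - f x)) \<longlonglongrightarrow> 0 \<and>
        (\<lambda>n. L2norm d (\<lambda>\<xi>. fourier_L1 d (\<phi> n) \<xi> - h \<xi>)) \<longlonglongrightarrow> 0)"

text \<open>
  For a closed set \<open>S\<close>, the (essential) support of an \<open>L\<^sup>2\<close> class is contained in \<open>S\<close> iff the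
  class vanishes almost everywhere outside \<open>S\<close>.
\<close>

definition fourier_supp_annulus :: "nat \<Rightarrow> real \<Rightarrow> ((nat \<Rightarrow> real) \<Rightarrow> complex) \<Rightarrow> bool" where
  "fourier_supp_annulus d A f \<longleftrightarrow>
     (\<exists>h. has_fourier d f h \<and>
        (AE \<xi> in Leb d. \<not> (1 / A \<le> L2_set \<xi> {..<d} \<and> L2_set \<xi> {..<d} \<le> A) \<longrightarrow> h \<xi> = 0))"

text \<open>\<open>u\<close> is a representative of the image of \<open>f\<close> under the Fourier multiplier with symbol \<open>m\<close>.\<close>

definition is_multiplier_image ::
    "nat \<Rightarrow> ((nat \<Rightarrow> real) \<Rightarrow> complex) \<Rightarrow> ((nat \<Rightarrow> real) \<Rightarrow> complex) \<Rightarrow> ((nat \<Rightarrow> real) \<Rightarrow> complex) \<Rightarrow> bool" where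
  "is_multiplier_image d m f u \<longleftrightarrow>
     (\<exists>h. has_fourier d f h \<and> has_fourier d u (\<lambda>\<xi>. m \<xi> * h \<xi>))"

text \<open>
  \<open>u t\<close> represents the wave, respectively Schroedinger, evolution of \<open>f\<close> at each time \<open>t\<close>. The
  representative is free at each time; mixed norms do not depend on it, as their
  inner norm is taken at fixed time.
\<close>

definition wave_evolution ::
    "nat \<Rightarrow> ((nat \<Rightarrow> real) \<Rightarrow> complex) \<Rightarrow> (real \<Rightarrow> (nat \<Rightarrow> real) \<Rightarrow> complex) \<Rightarrow> bool" where
  "wave_evolution d f u \<longleftrightarrow>
     (\<forall>t. is_multiplier_image d (\<lambda>\<xi>. cis (t * L2_set \<xi> {..<d})) f (u t))"

definition schroedinger_evolution ::
    "nat \<Rightarrow> ((nat \<Rightarrow> real) \<Rightarrow> complex) \<Rightarrow> (real \<Rightarrow> (nat \<Rightarrow> real) \<Rightarrow> complex) \<Rightarrow> bool" where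
  "schroedinger_evolution d g v \<longleftrightarrow>
     (\<forall>t. is_multiplier_image d (\<lambda>\<xi>. cis (- t * (L2_set \<xi> {..<d})\<^sup>2)) g (v t))"

end

theory Submission
  imports Defs "HOL-Probability.Characteristic_Functions"
begin

text \<open>
  The estimate is tested on one pair of data, depending on a small \<open>\<delta>\<close>, whose two evolutions stay
  together for a time of order \<open>1 / \<delta>\<^sup>2\<close>. At frequency \<open>\<xi>\<close> the wave equation moves with velocity
  \<open>- \<xi> / \<bar>\<xi>\<bar>\<close> and the Schroedinger equation with velocity \<open>2 \<xi>\<close>. So a wave packet at the first unit
  vector \<open>e\<close> and a Schroedinger packet at \<open>- e / 2\<close> have the same velocity \<open>- e\<close>, and an
  annulus with \<open>A \<ge> 4\<close> contains both frequencies with some room.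

  Let the transform of \<open>f\<close> be a bump at \<open>e\<close> of width \<open>1 / 4\<close> along \<open>e\<close> and \<open>\<delta>\<close> across, and that
  of \<open>g\<close> a bump at \<open>- e / 2\<close> of width \<open>\<delta>\<close> in all directions. The symbol \<open>\<bar>\<xi>\<bar>\<close> is linear along
  rays, hence differs from \<open>\<xi> \<bullet> e\<close> only by \<open>O(\<delta>\<^sup>2)\<close> on the first bump, although this bump is long; on the
  second bump \<open>\<bar>\<xi>\<bar>\<^sup>2\<close> differs from an affine function by \<open>O(\<delta>\<^sup>2)\<close> too. Up to times
  \<open>1 / (2 \<delta>\<^sup>2)\<close> the oscillating integrals therefore have almost constant phase, and no cancellation, at every
  point \<open>x\<close> of the slab \<open>\<bar>x\<^sub>0 + t\<bar> \<le> 1 / 2\<close>, \<open>\<bar>x\<^sub>i\<bar> \<le> 1 / (2 \<delta>)\<close>, whose volume is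
  \<open>\<delta> powr (1 - d)\<close> (\<open>wave_phase\<close>, \<open>schroedinger_phase\<close>, \<open>inv_fourier_packet_ge\<close>). There the
  solutions are at least constants times the volumes of the bumps,
  \<open>\<delta> powr (d - 1)\<close> and \<open>\<delta> powr d\<close>, while the norms of the data are at most constants times the square roots
  of these volumes (\<open>L2norm_packet_le\<close>). Inserting this into the estimate gives
  \<open>\<delta> powr (2 d - 1 - (d - 1) / r - 2 / q) \<le> const * \<delta> powr (d - 1 / 2)\<close> (\<open>scaling_bound\<close>), and
  \<open>\<delta> \<rightarrow> 0\<close> compares the exponents. This is the first inequality. For \<open>d = 2\<close> it implies the second one, because
  \<open>1 / r \<ge> 0\<close>; for \<open>d \<ge> 3\<close> the second one is weaker than \<open>q \<ge> 1\<close>.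

  The analytic part is to know that these explicit oscillating integrals are the evolutions, that
  is, that the inverse Fourier integral of a compactly supported Lipschitz function \<open>H\<close> has transform
  \<open>H\<close> in the square integrable sense (\<open>has_fourier_inv_fourier\<close>). The inverse integral is multiplied by a wide
  Gaussian, which makes it integrable; by Fubini's theorem its transform becomes an
  average of \<open>H\<close> over a narrow Gaussian, and the Lipschitz bound makes the error small. The
  same computation, paired with \<open>H\<close> itself, bounds the norm of the inverse integral.
\<close>

section \<open>Gaussian integrals in several variables\<close>

definition damp :: "nat \<Rightarrow> real \<Rightarrow> (nat \<Rightarrow> real) \<Rightarrow> real" where
  "damp d s x = (\<Prod>i<d. exp (- (s * x i)\<^sup>2 / 2))"

text \<open>The Fourier transform of the damping factor, recentred at \<open>\<eta>\<close> and with total mass one. It concentrates at \<open>\<eta>\<close> as \<open>s \<rightarrow> 0\<close>.\<close>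

definition heat :: "nat \<Rightarrow> real \<Rightarrow> (nat \<Rightarrow> real) \<Rightarrow> (nat \<Rightarrow> real) \<Rightarrow> real" where
  "heat d s \<eta> \<xi> = (\<Prod>i<d. normal_density (\<eta> i) s (\<xi> i))"

text \<open>The normalisation inverts \<open>fourier_L1\<close>, whose phase is \<open>x \<bullet> \<xi>\<close> and which has no constant in front.\<close>

definition inv_fourier ::
    "nat \<Rightarrow> ((nat \<Rightarrow> real) \<Rightarrow> complex) \<Rightarrow> (nat \<Rightarrow> real) \<Rightarrow> complex" where
  "inv_fourier d H x =
     complex_of_real (1 / (2 * pi) ^ d) * (LINT \<xi>|Leb d. cis (\<Sum>i<d. x i * \<xi> i) * H \<xi>)"

interpretation lborel_prod: product_sigma_finite "\<lambda>_::nat. lborel :: real measure"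
  by unfold_locales

lemma sigma_finite_Leb: "sigma_finite_measure (Leb d)"
  unfolding Leb_def by (rule lborel_prod.sigma_finite) simp

interpretation Leb: sigma_finite_measure "Leb d" for d
  by (rule sigma_finite_Leb)

interpretation LebLeb: pair_sigma_finite "Leb d" "Leb d" for d
  by unfold_locales

lemma coord_measurable_Leb [measurable]: "i < d \<Longrightarrow> (\<lambda>x. x i) \<in> borel_measurable (Leb d)"
  unfolding Leb_def by (simp add: measurable_component_singleton[of i "{..<d}" "\<lambda>_. lborel", simplified])

lemma cis_measurable [measurable]: "cis \<in> borel_measurable borel"
  by (intro borel_measurable_continuous_onI continuous_intros)

lemma cnj_measurable [measurable]: "cnj \<in> borel_measurable borel"
  by (intro borel_measurable_continuous_onI continuous_intros)

lemma cis_sum: "finite I \<Longrightarrow> cis (\<Sum>i\<in>I. f i) = (\<Prod>i\<in>I. cis (f i))"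
  by (induction I rule: finite_induct) (auto simp: cis_mult[symmetric])

text \<open>This is the characteristic function of the standard normal distribution after the substitution
  \<open>z = s x\<close>. The value is written with the normal density because the transform of a damping factor acts
  below as an averaging kernel of total mass one.\<close>

lemma gaussian_fourier_1d:
  fixes s y :: real
  assumes s: "s > 0"
  shows "integrable lborel (\<lambda>x. complex_of_real (exp (- (s * x)\<^sup>2 / 2)) * cis (x * y))" (is ?I)
    and "(LINT x|lborel. complex_of_real (exp (- (s * x)\<^sup>2 / 2)) * cis (x * y))
           = complex_of_real (2 * pi * normal_density 0 s y)" (is ?E)
proof -
  let ?g = "\<lambda>z. complex_of_real (std_normal_density z) * cis (y / s * z)"
  have int: "integrable lborel ?g"
    by (rule Bochner_Integration.integrable_bound[OF integrable_normal_density[of 1 0]])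
       (auto simp: norm_mult)
  have val: "(LINT z|lborel. ?g z) = complex_of_real (exp (- (y / s)\<^sup>2 / 2))"
  proof -
    have "char std_normal_distribution (y / s) = (LINT z|lborel. ?g z)"
      unfolding char_def
      by (subst integral_density) (auto simp: cis_conv_exp scaleR_conv_of_real mult_ac)
    then show ?thesis
      by (simp add: char_std_normal_distribution)
  qed
  have eq: "complex_of_real (exp (- (s * x)\<^sup>2 / 2)) * cis (x * y)
      = complex_of_real (sqrt (2 * pi)) * ?g (0 + s * x)" for x
    using s by (simp add: normal_density_def mult_ac)
  show ?I
    unfolding eq using lborel_integrable_real_affine[OF int, of s 0] s
    by (intro integrable_mult_right) simp
  have "(LINT z|lborel. ?g z) = s *\<^sub>R (LINT x|lborel. ?g (0 + s * x))"
    using lborel_integral_real_affine[of s ?g 0] s by simp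
  then have scaled: "(LINT x|lborel. ?g (0 + s * x)) = complex_of_real (exp (- (y / s)\<^sup>2 / 2) / s)"
    using s unfolding val by (simp add: field_simps scaleR_conv_of_real)
  have const: "sqrt (2 * pi) * (exp (- (y / s)\<^sup>2 / 2) / s) = 2 * pi * normal_density 0 s y"
  proof -
    define r where "r = sqrt (2 * pi)"
    have r: "2 * pi = r * r" "r > 0" by (simp_all add: r_def)
    have "normal_density 0 s y = exp (- (y / s)\<^sup>2 / 2) / (r * s)"
      using s by (simp add: normal_density_def power_divide real_sqrt_mult r_def mult.commute)
    then show ?thesis
      using s r(2) unfolding r_def[symmetric] r(1) by simp
  qed
  show ?E
    unfolding eq integral_mult_right_zero scaled of_real_mult[symmetric] const ..
qed

lemma gaussian_fourier:
  assumes s: "s > 0"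
  shows "(LINT x|Leb d. complex_of_real (damp d s x) * cis (\<Sum>i<d. x i * (\<xi> i - \<eta> i)))
           = complex_of_real ((2 * pi) ^ d * heat d s \<eta> \<xi>)"
proof -
  have "(LINT x|Leb d. complex_of_real (damp d s x) * cis (\<Sum>i<d. x i * (\<xi> i - \<eta> i)))
     = (LINT x|Leb d. (\<Prod>i<d. complex_of_real (exp (- (s * x i)\<^sup>2 / 2)) * cis (x i * (\<xi> i - \<eta> i))))"
    by (simp add: damp_def cis_sum prod.distrib)
  also have "\<dots> = (\<Prod>i<d. LINT x|lborel. complex_of_real (exp (- (s * x)\<^sup>2 / 2)) * cis (x * (\<xi> i - \<eta> i)))"
    unfolding Leb_def
    by (intro lborel_prod.product_integral_prod gaussian_fourier_1d(1) s) simp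
  also have "\<dots> = (\<Prod>i<d. complex_of_real (2 * pi * normal_density (\<eta> i) s (\<xi> i)))"
    unfolding gaussian_fourier_1d(2)[OF s] by (simp add: normal_density_def)
  also have "\<dots> = complex_of_real ((2 * pi) ^ d * heat d s \<eta> \<xi>)"
    by (simp add: heat_def prod.distrib power_mult_distrib)
  finally show ?thesis .
qed

lemma damp_measurable [measurable]: "damp d s \<in> borel_measurable (Leb d)"
  unfolding damp_def by measurable

lemma damp_nonneg [simp]: "0 \<le> damp d s x" by (simp add: damp_def prod_nonneg)

lemma damp_le_1 [simp]: "damp d s x \<le> 1"
  unfolding damp_def by (rule prod_le_1) auto

lemma integrable_damp: "s > 0 \<Longrightarrow> integrable (Leb d) (damp d s)"
  unfolding damp_def Leb_def
  using gaussian_fourier_1d(1)[of s 0]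
  by (intro lborel_prod.product_integrable_prod) (auto simp: complex_of_real_integrable_eq)

lemma damp_tendsto_1: "(\<lambda>n. damp d (inverse (real (Suc n))) x) \<longlonglongrightarrow> 1"
proof -
  have "(\<lambda>n. damp d (inverse (real (Suc n))) x) \<longlonglongrightarrow> (\<Prod>i<d. exp (- (0 * x i)\<^sup>2 / 2))"
    unfolding damp_def by (intro tendsto_intros LIMSEQ_inverse_real_of_nat) auto
  then show ?thesis by simp
qed

lemma heat_nonneg [simp]: "0 \<le> heat d s \<eta> \<xi>" by (simp add: heat_def prod_nonneg)

lemma heat_commute: "heat d s \<eta> \<xi> = heat d s \<xi> \<eta>"
  by (simp add: heat_def normal_density_def power2_commute)

lemma heat_measurable [measurable]: "heat d s \<eta> \<in> borel_measurable (Leb d)"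
  unfolding heat_def normal_density_def by measurable

lemma nn_integral_normal_density: "s > 0 \<Longrightarrow> (\<integral>\<^sup>+x. ennreal (normal_density m s x) \<partial>lborel) = 1"
  by (subst nn_integral_eq_integral) (auto simp: integral_normal_density)

lemma nn_integral_heat:
  assumes s: "s > 0"
  shows "(\<integral>\<^sup>+\<xi>. ennreal (heat d s \<eta> \<xi>) \<partial>Leb d) = 1"
proof -
  have "(\<integral>\<^sup>+\<xi>. ennreal (heat d s \<eta> \<xi>) \<partial>Leb d)
      = (\<integral>\<^sup>+\<xi>. (\<Prod>i<d. ennreal (normal_density (\<eta> i) s (\<xi> i))) \<partial>Leb d)"
    by (simp add: heat_def prod_ennreal)
  also have "\<dots> = (\<Prod>i<d. \<integral>\<^sup>+x. ennreal (normal_density (\<eta> i) s x) \<partial>lborel)"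
    unfolding Leb_def by (intro lborel_prod.product_nn_integral_prod) auto
  finally show ?thesis
    using s by (simp add: nn_integral_normal_density)
qed

text \<open>Moments of first order suffice for the error bound \<open>fourier_damped_error\<close>. All factors of the
  product except the one at \<open>j\<close> integrate to one.\<close>

lemma nn_integral_heat_moment:
  assumes s: "s > 0" and j: "j < d"
  shows "(\<integral>\<^sup>+\<xi>. ennreal (heat d s \<eta> \<xi> * \<bar>\<xi> j - \<eta> j\<bar>) \<partial>Leb d) = ennreal (s * sqrt (2 / pi))"
proof -
  \<comment> \<open>The weight is put into the factor at \<open>j\<close>, so that the integrand is again a product.\<close>
  let ?f = "\<lambda>i x. normal_density (\<eta> i) s x * (if i = j then \<bar>x - \<eta> j\<bar> else 1)"
  have "heat d s \<eta> \<xi> * \<bar>\<xi> j - \<eta> j\<bar> = (\<Prod>i<d. ?f i (\<xi> i))" for \<xi>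
    using j unfolding prod.distrib heat_def by (simp add: prod.delta)
  then have "(\<integral>\<^sup>+\<xi>. ennreal (heat d s \<eta> \<xi> * \<bar>\<xi> j - \<eta> j\<bar>) \<partial>Leb d)
      = (\<integral>\<^sup>+\<xi>. (\<Prod>i<d. ennreal (?f i (\<xi> i))) \<partial>Leb d)"
    by (simp add: prod_ennreal)
  also have "\<dots> = (\<Prod>i<d. \<integral>\<^sup>+x. ennreal (?f i x) \<partial>lborel)"
    unfolding Leb_def by (intro lborel_prod.product_nn_integral_prod) auto
  also have "\<dots> = (\<Prod>i<d. if i = j then ennreal (s * sqrt (2 / pi)) else 1)"
  proof (intro prod.cong refl)
    fix i
    have "(\<integral>\<^sup>+x. ennreal (normal_density (\<eta> j) s x * \<bar>x - \<eta> j\<bar>) \<partial>lborel) = ennreal (s * sqrt (2 / pi))"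
      using normal_moment_abs_odd[OF s, of "\<eta> j" 0]
      by (subst nn_integral_eq_integral) (auto simp: has_bochner_integral_iff)
    then show "(\<integral>\<^sup>+x. ennreal (?f i x) \<partial>lborel) = (if i = j then ennreal (s * sqrt (2 / pi)) else 1)"
      using s by (simp add: nn_integral_normal_density)
  qed
  finally show ?thesis using j by (simp add: prod.delta)
qed

lemma heat_integral:
  assumes "s > 0"
  shows "integrable (Leb d) (heat d s \<eta>)" "(LINT \<xi>|Leb d. heat d s \<eta> \<xi>) = 1"
proof -
  show "integrable (Leb d) (heat d s \<eta>)"
    using nn_integral_heat[OF assms] by (intro integrableI_nonneg) auto
  then show "(LINT \<xi>|Leb d. heat d s \<eta> \<xi>) = 1"
    using nn_integral_heat[OF assms, of d \<eta>]
    by (subst integral_eq_nn_integral) auto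
qed

text \<open>The heat kernel is a probability density, so it integrates every bounded function.\<close>

lemma integrable_heat_bounded:
  fixes g :: "_ \<Rightarrow> 'b :: {real_normed_algebra_1, banach, second_countable_topology}"
  assumes s: "s > 0" and [measurable]: "g \<in> borel_measurable (Leb d)" and g: "\<And>\<xi>. norm (g \<xi>) \<le> B"
  shows "integrable (Leb d) (\<lambda>\<xi>. of_real (heat d s \<eta> \<xi>) * g \<xi>)"
proof -
  have dominant: "integrable (Leb d) (\<lambda>\<xi>. heat d s \<eta> \<xi> * B)"
    by (intro integrable_mult_left heat_integral s)
  have dominated: "norm (of_real (heat d s \<eta> \<xi>) * g \<xi>) \<le> norm (heat d s \<eta> \<xi> * B)" for \<xi>
  proof -
    have "norm (of_real (heat d s \<eta> \<xi>) * g \<xi>) \<le> heat d s \<eta> \<xi> * norm (g \<xi>)"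
      by (rule order_trans[OF norm_mult_ineq]) simp
    also have "\<dots> \<le> heat d s \<eta> \<xi> * B"
      by (rule mult_left_mono[OF g heat_nonneg])
    finally show ?thesis by simp
  qed
  show ?thesis
    by (rule Bochner_Integration.integrable_bound[OF dominant _ AE_I2[OF dominated]]) measurable
qed


text \<open>The integrability premise for exchanging the complex integrals below.\<close>

lemma integrable_tensor:
  fixes \<phi> \<psi> :: "(nat \<Rightarrow> real) \<Rightarrow> complex"
  assumes \<phi>: "integrable (Leb d) \<phi>" and \<psi>: "integrable (Leb d) \<psi>"
    and F [measurable]: "F \<in> borel_measurable (Leb d \<Otimes>\<^sub>M Leb d)"
    and F_le: "\<And>x y. norm (F (x, y)) \<le> norm (\<phi> x) * norm (\<psi> y)"
  shows "integrable (Leb d \<Otimes>\<^sub>M Leb d) (F :: _ \<Rightarrow> complex)"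
proof -
  have [measurable]: "\<phi> \<in> borel_measurable (Leb d)" "\<psi> \<in> borel_measurable (Leb d)"
    using \<phi> \<psi> by auto
  have "integrable (Leb d \<Otimes>\<^sub>M Leb d) (\<lambda>(x, y). norm (\<phi> x) * norm (\<psi> y))"
    by (intro LebLeb.Fubini_integrable) (auto intro!: \<phi> \<psi> AE_I2)
  then show ?thesis
    by (rule Bochner_Integration.integrable_bound) (use F_le in \<open>auto simp: split_beta\<close>)
qed

lemma inverse_two_pi_power_le_1: "1 / (2 * pi) ^ d \<le> (1::real)"
proof -
  have "(1::real) \<le> (2 * pi) ^ d"
    using pi_gt3 by (intro one_le_power) linarith
  then show ?thesis by (simp add: divide_le_eq_1)
qed

section \<open>Square integrable functions\<close>

lemma L2norm_eq: "L2norm d f = ennreal_powr (\<integral>\<^sup>+x. ennreal ((norm (f x))\<^sup>2) \<partial>Leb d) (1 / 2)"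
proof -
  have "real_of_ereal 2 = 2" by simp
  moreover have "(2::ereal) \<noteq> \<infinity>" by simp
  ultimately show ?thesis
    by (simp add: L2norm_def Lnorm_def ennreal_powr_def)
qed

lemma L2norm_le:
  assumes "0 \<le> b" "(\<integral>\<^sup>+x. ennreal ((norm (f x))\<^sup>2) \<partial>Leb d) \<le> ennreal (b\<^sup>2)"
  shows "L2norm d f \<le> ennreal b"
proof -
  let ?I = "\<integral>\<^sup>+x. ennreal ((norm (f x))\<^sup>2) \<partial>Leb d"
  have "?I \<noteq> \<infinity>" using assms(2) by (auto simp: top_unique)
  moreover have "enn2real ?I \<le> b\<^sup>2"
    using assms(2) by (simp add: enn2real_leI)
  then have "sqrt (enn2real ?I) \<le> b"
    using assms(1) by (intro real_le_lsqrt)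
  then have "enn2real ?I powr (1 / 2) \<le> b"
    by (simp only: powr_half_sqrt[OF enn2real_nonneg])
  ultimately show ?thesis
    by (simp add: L2norm_eq ennreal_powr_def ennreal_leI)
qed

lemma L2norm_tendsto_0:
  assumes "(\<lambda>n. \<integral>\<^sup>+x. ennreal ((norm (F n x))\<^sup>2) \<partial>Leb d) \<longlonglongrightarrow> 0"
  shows "(\<lambda>n. L2norm d (F n)) \<longlonglongrightarrow> 0"
proof (rule order_tendstoI)
  fix a :: ennreal assume "0 < a"
  then obtain c where c: "0 < c" "c < a" using dense by blast
  then obtain b where b: "c = ennreal b" "0 < b"
    by (cases c) auto
  have "\<forall>\<^sub>F n in sequentially. (\<integral>\<^sup>+x. ennreal ((norm (F n x))\<^sup>2) \<partial>Leb d) < ennreal (b\<^sup>2)"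
    using assms b by (intro order_tendstoD) auto
  then show "\<forall>\<^sub>F n in sequentially. L2norm d (F n) < a"
  proof (rule eventually_mono)
    fix n assume "(\<integral>\<^sup>+x. ennreal ((norm (F n x))\<^sup>2) \<partial>Leb d) < ennreal (b\<^sup>2)"
    then have "L2norm d (F n) \<le> ennreal b"
      using b(2) by (intro L2norm_le less_imp_le) simp_all
    then show "L2norm d (F n) < a"
      using b(1) c(2) by (simp add: le_less_trans)
  qed
qed auto

section \<open>Functions with a prescribed Lipschitz Fourier transform\<close>

text \<open>The bound by one and the support of finite measure give at once that \<open>H\<close> is integrable
  and square integrable, with both integrals at most the measure of \<open>K\<close>. The support condition
  is restricted to the points of the measure space, since the other functions on \<open>nat\<close> belong to no
  measurable set.\<close>

locale fourier_datum =
  fixes d :: nat and H :: "(nat \<Rightarrow> real) \<Rightarrow> complex" and K :: "(nat \<Rightarrow> real) set"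
  assumes H_measurable [measurable]: "H \<in> borel_measurable (Leb d)"
    and K_measurable [measurable]: "K \<in> sets (Leb d)"
    and K_finite: "emeasure (Leb d) K < \<infinity>"
    and H_le_1: "norm (H \<xi>) \<le> 1"
    and H_support: "\<lbrakk>\<xi> \<in> space (Leb d); \<xi> \<notin> K\<rbrakk> \<Longrightarrow> H \<xi> = 0"
begin

lemma H_bound: "\<xi> \<in> space (Leb d) \<Longrightarrow> norm (H \<xi>) \<le> indicator K \<xi>"
  using H_le_1[of \<xi>] H_support[of \<xi>] by (auto simp: indicator_def)

lemma integrable_indicator_K: "integrable (Leb d) (indicator K :: _ \<Rightarrow> real)"
  using K_finite by (intro integrable_real_indicator) auto

lemma integrable_H: "integrable (Leb d) H"
  by (rule Bochner_Integration.integrable_bound[OF integrable_indicator_K]) (use H_bound in auto)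

lemma integral_norm_H_le: "(LINT \<xi>|Leb d. norm (H \<xi>)) \<le> measure (Leb d) K"
proof -
  have "(LINT \<xi>|Leb d. norm (H \<xi>)) \<le> (LINT \<xi>|Leb d. indicator K \<xi>)"
    by (intro integral_mono integrable_norm integrable_H integrable_indicator_K H_bound)
  then show ?thesis by (simp add: K_finite sets.Int_space_eq1)
qed

lemma inv_fourier_measurable [measurable]: "inv_fourier d H \<in> borel_measurable (Leb d)"
proof -
  have "(\<lambda>(x, \<xi>). cis (\<Sum>i<d. x i * \<xi> i) * H \<xi>) \<in> borel_measurable (Leb d \<Otimes>\<^sub>M Leb d)"
    by measurable
  then show ?thesis
    unfolding inv_fourier_def
    by (intro borel_measurable_times borel_measurable_const Leb.borel_measurable_lebesgue_integral) auto
qed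

lemma norm_inv_fourier_le: "norm (inv_fourier d H x) \<le> measure (Leb d) K"
proof -
  have "norm (LINT \<xi>|Leb d. cis (\<Sum>i<d. x i * \<xi> i) * H \<xi>) \<le> (LINT \<xi>|Leb d. norm (H \<xi>))"
    by (rule order_trans[OF integral_norm_bound]) (simp add: norm_mult)
  also note integral_norm_H_le
  finally have *: "norm (LINT \<xi>|Leb d. cis (\<Sum>i<d. x i * \<xi> i) * H \<xi>) \<le> measure (Leb d) K" .
  have "norm (inv_fourier d H x) \<le> 1 * norm (LINT \<xi>|Leb d. cis (\<Sum>i<d. x i * \<xi> i) * H \<xi>)"
    unfolding inv_fourier_def norm_mult norm_of_real
    using inverse_two_pi_power_le_1[of d] by (intro mult_right_mono) auto
  with * show ?thesis by simp
qed

abbreviation damped :: "real \<Rightarrow> (nat \<Rightarrow> real) \<Rightarrow> complex" where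
  "damped s x \<equiv> complex_of_real (damp d s x) * inv_fourier d H x"

lemma integrable_damped: "s > 0 \<Longrightarrow> integrable (Leb d) (damped s)"
proof -
  assume "s > 0"
  then have "integrable (Leb d) (\<lambda>x. measure (Leb d) K * damp d s x)"
    by (intro integrable_mult_right integrable_damp)
  then show ?thesis
    by (rule Bochner_Integration.integrable_bound)
       (auto intro!: mult_left_mono norm_inv_fourier_le simp: norm_mult mult.commute[of "measure _ _"])
qed

text \<open>By Fubini's theorem the \<open>x\<close>-integral can be carried out first; it is the transform of a Gaussian.
  The transform of the damped function is therefore the heat flow of \<open>H\<close>.\<close>

lemma fourier_damped:
  assumes s: "s > 0"
  shows "fourier_L1 d (damped s) \<eta> = (LINT \<xi>|Leb d. complex_of_real (heat d s \<eta> \<xi>) * H \<xi>)"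
proof -
  define F where "F x \<xi> = complex_of_real (damp d s x) * cis (\<Sum>i<d. x i * (\<xi> i - \<eta> i)) * H \<xi>" for x \<xi>
  have F: "integrable (Leb d \<Otimes>\<^sub>M Leb d) (\<lambda>(x, \<xi>). F x \<xi>)"
  proof (rule integrable_tensor)
    show "integrable (Leb d) (\<lambda>x. complex_of_real (damp d s x))"
      using s by (simp add: complex_of_real_integrable_eq integrable_damp)
    show "(\<lambda>(x, \<xi>). F x \<xi>) \<in> borel_measurable (Leb d \<Otimes>\<^sub>M Leb d)"
      unfolding F_def by measurable
  qed (use integrable_H in \<open>auto simp: F_def norm_mult\<close>)
  let ?c = "complex_of_real (1 / (2 * pi) ^ d)"
  have split: "cis (\<Sum>i<d. x i * (\<xi> i - \<eta> i)) = cis (\<Sum>i<d. x i * \<xi> i) * cis (- (\<Sum>i<d. x i * \<eta> i))"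
    for x \<xi> :: "nat \<Rightarrow> real"
    unfolding cis_mult by (simp add: right_diff_distrib sum_subtractf)
  have "cis (- (\<Sum>i<d. x i * \<eta> i)) * damped s x = ?c * (LINT \<xi>|Leb d. F x \<xi>)" for x
  proof -
    have "(LINT \<xi>|Leb d. F x \<xi>) = (LINT \<xi>|Leb d. (complex_of_real (damp d s x) * cis (- (\<Sum>i<d. x i * \<eta> i)))
        * (cis (\<Sum>i<d. x i * \<xi> i) * H \<xi>))"
      by (intro Bochner_Integration.integral_cong refl) (simp add: F_def split mult_ac)
    then show ?thesis
      by (simp add: inv_fourier_def)
  qed
  then have "fourier_L1 d (damped s) \<eta> = ?c * (LINT x|Leb d. LINT \<xi>|Leb d. F x \<xi>)"
    by (simp add: fourier_L1_def)
  also have "\<dots> = ?c * (LINT \<xi>|Leb d. LINT x|Leb d. F x \<xi>)"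
    using LebLeb.Fubini_integral[OF F] by simp
  also have "\<dots> = ?c * (LINT \<xi>|Leb d. complex_of_real ((2 * pi) ^ d) * (complex_of_real (heat d s \<eta> \<xi>) * H \<xi>))"
    unfolding F_def integral_mult_left_zero gaussian_fourier[OF s] by (simp add: mult.assoc)
  also have "\<dots> = (LINT \<xi>|Leb d. complex_of_real (heat d s \<eta> \<xi>) * H \<xi>)"
    by simp
  finally show ?thesis .
qed

lemma norm_fourier_damped_le:
  assumes s: "s > 0"
  shows "norm (fourier_L1 d (damped s) \<eta>) \<le> 1"
proof -
  have "norm (fourier_L1 d (damped s) \<eta>) \<le> (LINT \<xi>|Leb d. heat d s \<eta> \<xi> * norm (H \<xi>))"
    unfolding fourier_damped[OF s] by (rule order_trans[OF integral_norm_bound]) (simp add: norm_mult)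
  also have "\<dots> \<le> (LINT \<xi>|Leb d. heat d s \<eta> \<xi>)"
    using integrable_heat_bounded[OF s, where d = d and g = "\<lambda>\<xi>. norm (H \<xi>)" and B = 1 and \<eta> = \<eta>]
    by (intro integral_mono heat_integral s) (auto simp: H_le_1 intro: mult_left_le)
  finally show ?thesis using heat_integral[OF s] by simp
qed

text \<open>The weighted square is the damped function times the conjugate of \<open>inv_fourier d H\<close>. Writing the
  second factor as an integral and exchanging the integrals pairs the conjugate of \<open>H\<close> with the transform
  of the damped function, which is bounded by one. The bound does not depend on \<open>s\<close>; this uniformity
  replaces Plancherel's theorem.\<close>

lemma nn_integral_damp_inv_fourier_le:
  assumes s: "s > 0"
  shows "(\<integral>\<^sup>+x. ennreal (damp d s x * (norm (inv_fourier d H x))\<^sup>2) \<partial>Leb d)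
           \<le> ennreal (measure (Leb d) K)"
proof -
  let ?c = "1 / (2 * pi) ^ d :: real"
  define F where "F x \<eta> = damped s x * cis (- (\<Sum>i<d. x i * \<eta> i)) * cnj (H \<eta>)" for x \<eta>
  have F: "integrable (Leb d \<Otimes>\<^sub>M Leb d) (\<lambda>(x, \<eta>). F x \<eta>)"
    by (rule integrable_tensor[OF integrable_damped[OF s] integrable_H])
       (auto simp: F_def norm_mult)
  have pt: "complex_of_real (damp d s x * (norm (inv_fourier d H x))\<^sup>2) = ?c * (LINT \<eta>|Leb d. F x \<eta>)" for x
  proof -
    have "cnj (inv_fourier d H x) = ?c * (LINT \<eta>|Leb d. cis (- (\<Sum>i<d. x i * \<eta> i)) * cnj (H \<eta>))"
      unfolding inv_fourier_def by (simp flip: Bochner_Integration.integral_cnj add: cis_cnj)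
    moreover have "complex_of_real (damp d s x * (norm (inv_fourier d H x))\<^sup>2) = damped s x * cnj (inv_fourier d H x)"
      by (simp only: of_real_mult complex_norm_square mult.assoc)
    ultimately show ?thesis
      by (simp add: F_def mult.assoc)
  qed
  have I: "integrable (Leb d) (\<lambda>x. damp d s x * (norm (inv_fourier d H x))\<^sup>2)"
    using LebLeb.integrable_fst[OF F] 
    by (subst complex_of_real_integrable_eq[symmetric], unfold pt) (intro integrable_mult_right)
  have "complex_of_real (LINT x|Leb d. damp d s x * (norm (inv_fourier d H x))\<^sup>2)
      = ?c * (LINT x|Leb d. LINT \<eta>|Leb d. F x \<eta>)"
    unfolding integral_complex_of_real[symmetric] pt by simp
  also have "(LINT x|Leb d. LINT \<eta>|Leb d. F x \<eta>) = (LINT \<eta>|Leb d. LINT x|Leb d. F x \<eta>)"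
    using LebLeb.Fubini_integral[OF F] by simp
  also have "\<dots> = (LINT \<eta>|Leb d. fourier_L1 d (damped s) \<eta> * cnj (H \<eta>))"
    unfolding F_def fourier_L1_def by (simp add: mult_ac)
  finally have pairing: "complex_of_real (LINT x|Leb d. damp d s x * (norm (inv_fourier d H x))\<^sup>2)
      = ?c * (LINT \<eta>|Leb d. fourier_L1 d (damped s) \<eta> * cnj (H \<eta>))" .
  have "(LINT x|Leb d. damp d s x * (norm (inv_fourier d H x))\<^sup>2)
      \<le> norm (complex_of_real (LINT x|Leb d. damp d s x * (norm (inv_fourier d H x))\<^sup>2))"
    unfolding norm_of_real by (rule abs_ge_self)
  also have "\<dots> = norm (complex_of_real ?c) * norm (LINT \<eta>|Leb d. fourier_L1 d (damped s) \<eta> * cnj (H \<eta>))"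
    unfolding pairing norm_mult ..
  also have "\<dots> \<le> 1 * (LINT \<eta>|Leb d. norm (H \<eta>))"
  proof (intro mult_mono)
    show "norm (complex_of_real ?c) \<le> 1"
      unfolding norm_of_real using inverse_two_pi_power_le_1[of d] by simp
    show "norm (LINT \<eta>|Leb d. fourier_L1 d (damped s) \<eta> * cnj (H \<eta>)) \<le> (LINT \<eta>|Leb d. norm (H \<eta>))"
    proof (rule order_trans[OF integral_norm_bound], rule integral_mono')
      show "norm (fourier_L1 d (damped s) \<eta> * cnj (H \<eta>)) \<le> norm (H \<eta>)" for \<eta>
        using mult_right_mono[OF norm_fourier_damped_le[OF s], of "norm (H \<eta>)" \<eta>]
        by (simp add: norm_mult)
    qed (auto intro: integrable_norm integrable_H)
  qed auto
  also have "\<dots> \<le> measure (Leb d) K" using integral_norm_H_le by simp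
  finally show ?thesis
    using I by (subst nn_integral_eq_integral) (auto intro: ennreal_leI)
qed

text \<open>The damping is removed by Fatou's lemma.\<close>

lemma nn_integral_inv_fourier_le:
  "(\<integral>\<^sup>+x. ennreal ((norm (inv_fourier d H x))\<^sup>2) \<partial>Leb d) \<le> ennreal (measure (Leb d) K)"
proof -
  let ?f = "\<lambda>n x. ennreal (damp d (inverse (real (Suc n))) x * (norm (inv_fourier d H x))\<^sup>2)"
  have "(\<lambda>n. ?f n x) \<longlonglongrightarrow> ennreal (1 * (norm (inv_fourier d H x))\<^sup>2)" for x
    by (intro tendsto_ennrealI tendsto_intros damp_tendsto_1)
  then have "ennreal ((norm (inv_fourier d H x))\<^sup>2) = liminf (\<lambda>n. ?f n x)" for x
    by (intro lim_imp_Liminf[symmetric]) simp_all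
  then have "(\<integral>\<^sup>+x. ennreal ((norm (inv_fourier d H x))\<^sup>2) \<partial>Leb d) = (\<integral>\<^sup>+x. liminf (\<lambda>n. ?f n x) \<partial>Leb d)"
    by simp
  also have "\<dots> \<le> liminf (\<lambda>n. \<integral>\<^sup>+x. ?f n x \<partial>Leb d)"
    by (intro nn_integral_liminf) measurable
  also have "\<dots> \<le> liminf (\<lambda>n. ennreal (measure (Leb d) K))"
    by (intro Liminf_mono always_eventually allI nn_integral_damp_inv_fourier_le) simp
  also have "\<dots> = ennreal (measure (Leb d) K)"
    by (simp add: Liminf_const)
  finally show ?thesis .
qed

lemma L2norm_inv_fourier_le: "L2norm d (inv_fourier d H) \<le> ennreal (sqrt (measure (Leb d) K))"
  using nn_integral_inv_fourier_le by (intro L2norm_le) auto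

lemma inv_fourier_in_L2: "inv_fourier d H \<in> L2 d"
  unfolding L2_def using le_less_trans[OF L2norm_inv_fourier_le] by auto

lemma H_in_L2: "H \<in> L2 d"
proof -
  have "(norm (H x))\<^sup>2 \<le> indicator K x" if "x \<in> space (Leb d)" for x
    using H_bound[OF that] power_le_one[of "norm (H x)" 2] by (auto simp: indicator_def split: if_splits)
  then have "(\<integral>\<^sup>+x. ennreal ((norm (H x))\<^sup>2) \<partial>Leb d) \<le> (\<integral>\<^sup>+x. indicator K x \<partial>Leb d)"
    by (intro nn_integral_mono) (metis ennreal_indicator ennreal_leI)
  also have "\<dots> = ennreal ((sqrt (measure (Leb d) K))\<^sup>2)"
    using K_finite by (simp add: emeasure_eq_ennreal_measure)
  finally have "L2norm d H \<le> ennreal (sqrt (measure (Leb d) K))"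
    by (intro L2norm_le) auto
  then show ?thesis
    unfolding L2_def using le_less_trans[OF _ ennreal_less_top] by auto
qed

lemma damped_in_L2: 
  assumes s: "s > 0"
  shows "damped s \<in> L2 d"
proof -
  have "(norm (damped s x))\<^sup>2 \<le> (norm (inv_fourier d H x))\<^sup>2" for x
    by (intro power_mono) (auto simp: norm_mult intro: mult_left_le_one_le)
  then have "(\<integral>\<^sup>+x. ennreal ((norm (damped s x))\<^sup>2) \<partial>Leb d) \<le> (\<integral>\<^sup>+x. ennreal ((norm (inv_fourier d H x))\<^sup>2) \<partial>Leb d)"
    by (intro nn_integral_mono ennreal_leI)
  also note nn_integral_inv_fourier_le
  finally have "L2norm d (damped s) \<le> ennreal (sqrt (measure (Leb d) K))"
    by (intro L2norm_le) auto
  then show ?thesis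
    unfolding L2_def using le_less_trans[OF _ ennreal_less_top] by auto
qed

text \<open>Dominated convergence, with the square of the undamped function as majorant.\<close>

lemma damped_tendsto: "(\<lambda>n. L2norm d (\<lambda>x. damped (inverse (real (Suc n))) x - inv_fourier d H x)) \<longlonglongrightarrow> 0"
proof (rule L2norm_tendsto_0)
  let ?U = "inv_fourier d H"
  let ?s = "\<lambda>n. inverse (real (Suc n))"
  have eq: "(norm (damped s x - ?U x))\<^sup>2 = (1 - damp d s x)\<^sup>2 * (norm (?U x))\<^sup>2" for s x
  proof -
    have "damped s x - ?U x = complex_of_real (damp d s x - 1) * ?U x"
      by (simp add: algebra_simps)
    then show ?thesis
      by (simp only: norm_mult norm_of_real power_mult_distrib power2_abs) (simp add: power2_commute)
  qed
  have "(\<lambda>n. \<integral>\<^sup>+x. ennreal ((1 - damp d (?s n) x)\<^sup>2 * (norm (?U x))\<^sup>2) \<partial>Leb d) \<longlonglongrightarrow> (\<integral>\<^sup>+x. 0 \<partial>Leb d)"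
  proof (rule nn_integral_dominated_convergence[where w="\<lambda>x. ennreal ((norm (?U x))\<^sup>2)"])
    show "(\<integral>\<^sup>+x. ennreal ((norm (?U x))\<^sup>2) \<partial>Leb d) < \<infinity>"
      using nn_integral_inv_fourier_le le_less_trans by fastforce
    show "AE x in Leb d. ennreal ((1 - damp d (?s n) x)\<^sup>2 * (norm (?U x))\<^sup>2) \<le> ennreal ((norm (?U x))\<^sup>2)" for n
      by (intro AE_I2 ennreal_leI mult_left_le_one_le power_le_one) auto
    have "(\<lambda>n. ennreal ((1 - damp d (?s n) x)\<^sup>2 * (norm (?U x))\<^sup>2)) \<longlonglongrightarrow> ennreal ((1 - 1)\<^sup>2 * (norm (?U x))\<^sup>2)" for x
      by (intro tendsto_ennrealI tendsto_intros damp_tendsto_1)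
    then show "AE x in Leb d. (\<lambda>n. ennreal ((1 - damp d (?s n) x)\<^sup>2 * (norm (?U x))\<^sup>2)) \<longlonglongrightarrow> 0"
      by simp
  qed measurable
  then show "(\<lambda>n. \<integral>\<^sup>+x. ennreal ((norm (damped (?s n) x - ?U x))\<^sup>2) \<partial>Leb d) \<longlonglongrightarrow> 0"
    unfolding eq by simp
qed

text \<open>The heat kernel has total mass one, so the error at \<open>\<eta>\<close> is the average of \<open>H \<xi> - H \<eta>\<close>. The
  Lipschitz condition turns this into first moments of the kernel, which are multiples of \<open>s\<close>. As \<open>H \<xi> - H \<eta>\<close>
  vanishes unless one of the two points is in \<open>K\<close>, the integral over \<open>\<eta>\<close> is finite: the
  kernel is symmetric, and either point can be integrated over \<open>K\<close> last.\<close>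

lemma fourier_damped_error:
  assumes s: "s > 0" and L: "0 \<le> L"
    and lipschitz: "\<And>\<xi> \<eta>. \<xi> \<in> K \<Longrightarrow> norm (H \<xi> - H \<eta>) \<le> L * (\<Sum>i<d. \<bar>\<xi> i - \<eta> i\<bar>)"
  shows "(\<integral>\<^sup>+\<eta>. ennreal ((norm (fourier_L1 d (damped s) \<eta> - H \<eta>))\<^sup>2) \<partial>Leb d)
           \<le> ennreal (4 * L * real d * sqrt (2 / pi) * measure (Leb d) K * s)"
proof -
  define c where "c = s * sqrt (2 / pi)"
  have c: "0 \<le> c" using s by (simp add: c_def)
  define g where "g i \<eta> \<xi> = ennreal (heat d s \<eta> \<xi> * \<bar>\<xi> i - \<eta> i\<bar>)" for i \<eta> \<xi>
  have g_measurable [measurable]: "(\<lambda>(\<eta>, \<xi>). g i \<eta> \<xi>) \<in> borel_measurable (Leb d \<Otimes>\<^sub>M Leb d)" if "i < d" for i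
    unfolding g_def heat_def normal_density_def using that by measurable
  have g_int: "(\<integral>\<^sup>+\<xi>. g i \<eta> \<xi> \<partial>Leb d) = ennreal c" if "i < d" for i \<eta>
    unfolding g_def c_def using nn_integral_heat_moment[OF s that] .
  have g_sym: "g i \<eta> \<xi> = g i \<xi> \<eta>" for i \<eta> \<xi>
    by (simp add: g_def heat_commute abs_minus_commute)
  have pair: "norm (H \<xi> - H \<eta>) \<le> (L * (\<Sum>i<d. \<bar>\<xi> i - \<eta> i\<bar>)) * (indicator K \<xi> + indicator K \<eta>)"
    if "\<xi> \<in> space (Leb d)" "\<eta> \<in> space (Leb d)" for \<xi> \<eta>
  proof -
    have nn: "0 \<le> L * (\<Sum>i<d. \<bar>\<xi> i - \<eta> i\<bar>)"
      using L by (intro mult_nonneg_nonneg sum_nonneg) auto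
    consider "\<xi> \<in> K" | "\<eta> \<in> K" "\<xi> \<notin> K" | "\<xi> \<notin> K" "\<eta> \<notin> K" by blast
    then show ?thesis
    proof cases
      case 1
      then show ?thesis
        using lipschitz[of \<xi> \<eta>] nn by (auto simp: indicator_def)
    next
      case 2
      then show ?thesis
        using lipschitz[of \<eta> \<xi>] by (simp add: norm_minus_commute abs_minus_commute)
    next
      case 3
      then show ?thesis using H_support that by simp
    qed
  qed
  have pt: "ennreal ((norm (fourier_L1 d (damped s) \<eta> - H \<eta>))\<^sup>2)
      \<le> (\<integral>\<^sup>+\<xi>. (\<Sum>i<d. ennreal (2 * L) * (g i \<eta> \<xi> * indicator K \<xi> + g i \<eta> \<xi> * indicator K \<eta>)) \<partial>Leb d)"
    if \<eta>: "\<eta> \<in> space (Leb d)" for \<eta>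
  proof -
    let ?e = "norm (fourier_L1 d (damped s) \<eta> - H \<eta>)"
    have Hd: "norm (H \<xi> - H \<eta>) \<le> 2" for \<xi>
      using norm_triangle_ineq4[of "H \<xi>" "H \<eta>"] H_le_1[of \<xi>] H_le_1[of \<eta>] by simp
    have "integrable (Leb d) (\<lambda>\<xi>. complex_of_real (heat d s \<eta> \<xi>) * H \<xi>)"
      by (rule integrable_heat_bounded[OF s _ H_le_1]) simp
    moreover have "integrable (Leb d) (\<lambda>\<xi>. complex_of_real (heat d s \<eta> \<xi>) * H \<eta>)"
      by (rule integrable_heat_bounded[OF s, where B = "norm (H \<eta>)"]) auto
    moreover have "(LINT \<xi>|Leb d. complex_of_real (heat d s \<eta> \<xi>) * H \<eta>) = H \<eta>"
      using heat_integral(2)[OF s, of d \<eta>] by simp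
    ultimately have diff: "fourier_L1 d (damped s) \<eta> - H \<eta>
        = (LINT \<xi>|Leb d. complex_of_real (heat d s \<eta> \<xi>) * (H \<xi> - H \<eta>))"
      unfolding fourier_damped[OF s] by (simp add: right_diff_distrib Bochner_Integration.integral_diff)
    have I: "integrable (Leb d) (\<lambda>\<xi>. complex_of_real (heat d s \<eta> \<xi>) * (H \<xi> - H \<eta>))"
      by (rule integrable_heat_bounded[OF s _ Hd]) simp
    \<comment> \<open>Both functions are bounded by one, so the square of the error is at most twice the error itself.\<close>
    have "?e \<le> 2"
      using norm_triangle_ineq4[of "fourier_L1 d (damped s) \<eta>" "H \<eta>"]
        norm_fourier_damped_le[OF s, of \<eta>] H_le_1[of \<eta>] by simp
    then have "?e\<^sup>2 \<le> 2 * ?e"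
      by (simp add: power2_eq_square mult_right_mono)
    then have "ennreal (?e\<^sup>2) \<le> ennreal 2 * ennreal ?e"
      by (subst ennreal_mult[symmetric]) (auto intro: ennreal_leI)
    also have "\<dots> \<le> ennreal 2 * (\<integral>\<^sup>+\<xi>. ennreal (norm (complex_of_real (heat d s \<eta> \<xi>) * (H \<xi> - H \<eta>))) \<partial>Leb d)"
      unfolding diff by (intro mult_left_mono integral_norm_bound_ennreal I) simp
    also have "\<dots> = (\<integral>\<^sup>+\<xi>. ennreal 2 * ennreal (norm (complex_of_real (heat d s \<eta> \<xi>) * (H \<xi> - H \<eta>))) \<partial>Leb d)"
      by (rule nn_integral_cmult[symmetric]) measurable
    also have "\<dots> \<le> (\<integral>\<^sup>+\<xi>. (\<Sum>i<d. ennreal (2 * L) * (g i \<eta> \<xi> * indicator K \<xi> + g i \<eta> \<xi> * indicator K \<eta>)) \<partial>Leb d)"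
    proof (rule nn_integral_mono)
      fix \<xi> assume \<xi>: "\<xi> \<in> space (Leb d)"
      have "2 * norm (complex_of_real (heat d s \<eta> \<xi>) * (H \<xi> - H \<eta>))
          \<le> 2 * (heat d s \<eta> \<xi> * ((L * (\<Sum>i<d. \<bar>\<xi> i - \<eta> i\<bar>)) * (indicator K \<xi> + indicator K \<eta>)))"
        using mult_left_mono[OF pair[OF \<xi> \<eta>] heat_nonneg[of d s \<eta> \<xi>]] by (simp add: norm_mult)
      also have "\<dots> = (\<Sum>i<d. 2 * L * (heat d s \<eta> \<xi> * \<bar>\<xi> i - \<eta> i\<bar> * indicator K \<xi> + heat d s \<eta> \<xi> * \<bar>\<xi> i - \<eta> i\<bar> * indicator K \<eta>))"
        by (simp add: sum_distrib_left sum_distrib_right sum.distrib algebra_simps)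
      finally have "ennreal (2 * norm (complex_of_real (heat d s \<eta> \<xi>) * (H \<xi> - H \<eta>)))
         \<le> ennreal (\<Sum>i<d. 2 * L * (heat d s \<eta> \<xi> * \<bar>\<xi> i - \<eta> i\<bar> * indicator K \<xi> + heat d s \<eta> \<xi> * \<bar>\<xi> i - \<eta> i\<bar> * indicator K \<eta>))"
        by (rule ennreal_leI)
      also have "\<dots> = (\<Sum>i<d. ennreal (2 * L) * (g i \<eta> \<xi> * indicator K \<xi> + g i \<eta> \<xi> * indicator K \<eta>))"
        using L by (subst sum_ennreal[symmetric]) (auto simp: g_def ennreal_mult ennreal_plus ennreal_indicator)
      finally show "ennreal 2 * ennreal (norm (complex_of_real (heat d s \<eta> \<xi>) * (H \<xi> - H \<eta>)))
         \<le> (\<Sum>i<d. ennreal (2 * L) * (g i \<eta> \<xi> * indicator K \<xi> + g i \<eta> \<xi> * indicator K \<eta>))"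
        by (subst ennreal_mult[symmetric]) auto
    qed
    finally show ?thesis .
  qed
  have K_ennreal: "emeasure (Leb d) K = ennreal (measure (Leb d) K)"
    using K_finite by (simp add: emeasure_eq_ennreal_measure)
  have one: "(\<integral>\<^sup>+\<eta>. \<integral>\<^sup>+\<xi>. g i \<eta> \<xi> * indicator K \<eta> \<partial>Leb d \<partial>Leb d) = ennreal (c * measure (Leb d) K)" if "i < d" for i
  proof -
    have "(\<integral>\<^sup>+\<eta>. \<integral>\<^sup>+\<xi>. g i \<eta> \<xi> * indicator K \<eta> \<partial>Leb d \<partial>Leb d) = (\<integral>\<^sup>+\<eta>. ennreal c * indicator K \<eta> \<partial>Leb d)"
      using that by (intro nn_integral_cong) (subst nn_integral_multc, measurable, simp add: g_int)
    then show ?thesis using c by (simp add: nn_integral_cmult K_ennreal ennreal_mult)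
  qed
  have two: "(\<integral>\<^sup>+\<eta>. \<integral>\<^sup>+\<xi>. g i \<eta> \<xi> * indicator K \<xi> \<partial>Leb d \<partial>Leb d) = ennreal (c * measure (Leb d) K)" if "i < d" for i
  proof -
    have "(\<integral>\<^sup>+\<eta>. \<integral>\<^sup>+\<xi>. g i \<eta> \<xi> * indicator K \<xi> \<partial>Leb d \<partial>Leb d) = (\<integral>\<^sup>+\<xi>. \<integral>\<^sup>+\<eta>. g i \<eta> \<xi> * indicator K \<xi> \<partial>Leb d \<partial>Leb d)"
      using that by (intro LebLeb.Fubini'[symmetric]) measurable
    also have "\<dots> = (\<integral>\<^sup>+\<xi>. \<integral>\<^sup>+\<eta>. g i \<xi> \<eta> * indicator K \<xi> \<partial>Leb d \<partial>Leb d)"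
      by (subst g_sym) simp
    also note one[OF that]
    finally show ?thesis .
  qed
  have "(\<integral>\<^sup>+\<eta>. ennreal ((norm (fourier_L1 d (damped s) \<eta> - H \<eta>))\<^sup>2) \<partial>Leb d)
      \<le> (\<integral>\<^sup>+\<eta>. \<integral>\<^sup>+\<xi>. (\<Sum>i<d. ennreal (2 * L) * (g i \<eta> \<xi> * indicator K \<xi> + g i \<eta> \<xi> * indicator K \<eta>)) \<partial>Leb d \<partial>Leb d)"
    by (intro nn_integral_mono pt)
  also have "\<dots> = (\<Sum>i<d. ennreal (2 * L) * ((\<integral>\<^sup>+\<eta>. \<integral>\<^sup>+\<xi>. g i \<eta> \<xi> * indicator K \<xi> \<partial>Leb d \<partial>Leb d)
      + (\<integral>\<^sup>+\<eta>. \<integral>\<^sup>+\<xi>. g i \<eta> \<xi> * indicator K \<eta> \<partial>Leb d \<partial>Leb d)))"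
  proof -
    have [measurable]: "(\<lambda>\<eta>. \<integral>\<^sup>+\<xi>. g i \<eta> \<xi> * indicator K \<xi> \<partial>Leb d) \<in> borel_measurable (Leb d)"
      "(\<lambda>\<eta>. \<integral>\<^sup>+\<xi>. g i \<eta> \<xi> * indicator K \<eta> \<partial>Leb d) \<in> borel_measurable (Leb d)" if "i < d" for i
      using that by (auto intro!: Leb.borel_measurable_nn_integral)
    have [measurable]: "g i \<eta> \<in> borel_measurable (Leb d)" if "i < d" for i \<eta>
      unfolding g_def using that by measurable
    have "(\<integral>\<^sup>+\<xi>. (\<Sum>i<d. ennreal (2 * L) * (g i \<eta> \<xi> * indicator K \<xi> + g i \<eta> \<xi> * indicator K \<eta>)) \<partial>Leb d)
        = (\<Sum>i<d. ennreal (2 * L) * ((\<integral>\<^sup>+\<xi>. g i \<eta> \<xi> * indicator K \<xi> \<partial>Leb d) + (\<integral>\<^sup>+\<xi>. g i \<eta> \<xi> * indicator K \<eta> \<partial>Leb d)))" for \<eta>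
      by (subst nn_integral_sum) (auto intro!: sum.cong simp: nn_integral_cmult nn_integral_add)
    then show ?thesis
      by (simp only:, subst nn_integral_sum) (auto intro!: sum.cong simp: nn_integral_cmult nn_integral_add)
  qed
  also have "\<dots> = (\<Sum>i<d. ennreal (2 * L) * (ennreal (c * measure (Leb d) K) + ennreal (c * measure (Leb d) K)))"
    by (intro sum.cong refl) (simp add: one two)
  also have "ennreal (c * measure (Leb d) K) + ennreal (c * measure (Leb d) K) = ennreal (2 * (c * measure (Leb d) K))"
    using c by (simp only: mult_2) (rule ennreal_plus[symmetric], auto)
  also have "(\<Sum>i<d. ennreal (2 * L) * ennreal (2 * (c * measure (Leb d) K)))
      = ennreal (real d) * ennreal (2 * L * (2 * (c * measure (Leb d) K)))"
    using L c by (subst ennreal_mult[symmetric]) (auto simp: ennreal_of_nat_eq_real_of_nat)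
  also have "\<dots> = ennreal (real d * (2 * L * (2 * (c * measure (Leb d) K))))"
    using L c by (intro ennreal_mult[symmetric]) auto
  also have "real d * (2 * L * (2 * (c * measure (Leb d) K))) = 4 * L * real d * sqrt (2 / pi) * measure (Leb d) K * s"
    by (simp add: c_def)
  finally show ?thesis .
qed

text \<open>The functions \<open>damped s\<close> with \<open>s \<rightarrow> 0\<close> are the integrable approximations that the definition of
  the transform asks for.\<close>

lemma has_fourier_inv_fourier:
  assumes L: "0 \<le> L"
    and lipschitz: "\<And>\<xi> \<eta>. \<xi> \<in> K \<Longrightarrow> norm (H \<xi> - H \<eta>) \<le> L * (\<Sum>i<d. \<bar>\<xi> i - \<eta> i\<bar>)"
  shows "has_fourier d (inv_fourier d H) H"
  unfolding has_fourier_def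
proof (intro conjI exI allI)
  let ?s = "\<lambda>n. inverse (real (Suc n))"
  have "(\<lambda>n. ennreal (4 * L * real d * sqrt (2 / pi) * measure (Leb d) K * ?s n)) \<longlonglongrightarrow>
      ennreal (4 * L * real d * sqrt (2 / pi) * measure (Leb d) K * 0)"
    by (intro tendsto_ennrealI tendsto_intros LIMSEQ_inverse_real_of_nat)
  then have lim: "(\<lambda>n. ennreal (4 * L * real d * sqrt (2 / pi) * measure (Leb d) K * ?s n)) \<longlonglongrightarrow> 0"
    by simp
  have "(\<lambda>n. \<integral>\<^sup>+\<eta>. ennreal ((norm (fourier_L1 d (damped (?s n)) \<eta> - H \<eta>))\<^sup>2) \<partial>Leb d) \<longlonglongrightarrow> 0"
    by (rule tendsto_sandwich[OF _ _ tendsto_const lim])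
       (auto intro!: always_eventually fourier_damped_error L lipschitz simp del: of_nat_Suc)
  then show "(\<lambda>n. L2norm d (\<lambda>\<eta>. fourier_L1 d (damped (?s n)) \<eta> - H \<eta>)) \<longlonglongrightarrow> 0"
    by (rule L2norm_tendsto_0)
qed (auto intro!: inv_fourier_in_L2 H_in_L2 damped_in_L2 integrable_damped damped_tendsto simp del: of_nat_Suc)

end

section \<open>Lower bounds for mixed norms\<close>

lemma ennreal_powr_mono: "x \<le> y \<Longrightarrow> 0 \<le> p \<Longrightarrow> ennreal_powr x p \<le> ennreal_powr y p"
  by (auto simp: ennreal_powr_def less_top top_unique intro!: ennreal_leI powr_mono2 enn2real_mono)

lemma ennreal_powr_ennreal: "0 \<le> x \<Longrightarrow> ennreal_powr (ennreal x) p = ennreal (x powr p)"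
  by (simp add: ennreal_powr_def)

text \<open>The function \<open>f\<close> is arbitrary, so that the lemma applies to the inner norm as a function of time: the lower
  integral is monotone on all functions, and the essential supremum of a function that is not
  measurable is infinite. The power \<open>m powr 0 = 1\<close> covers \<open>p = \<infinity>\<close>.\<close>

lemma Lnorm_ge:
  assumes p: "1 \<le> p" and S [measurable]: "S \<in> sets M" and m: "emeasure M S = ennreal m" "0 < m"
    and c: "0 \<le> c" and f: "\<And>x. x \<in> S \<Longrightarrow> ennreal c \<le> f x"
  shows "ennreal (c * m powr real_of_ereal (1 / p)) \<le> Lnorm M p f"
proof (cases p)
  case PInf
  have "ennreal c \<le> esssup M f"
  proof (cases "f \<in> borel_measurable M")
    case True
    show ?thesis
    proof (rule ccontr)
      assume "\<not> ennreal c \<le> esssup M f"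
      then have "S \<subseteq> {x \<in> space M. f x > esssup M f}"
        using f sets.sets_into_space[OF S] by (auto simp: not_le intro: less_le_trans)
      then have "emeasure M S \<le> emeasure M {x \<in> space M. f x > esssup M f}"
        using True by (intro emeasure_mono) auto
      then show False using m by (simp add: esssup_zero_measure)
    qed
  qed (simp add: esssup_non_measurable)
  then show ?thesis using m by (simp add: Lnorm_def PInf)
next
  case (real P)
  have P: "1 \<le> P" using p by (simp add: real)
  have eq: "real_of_ereal (1 / p) = 1 / P"
    using P by (simp add: real one_ereal_def)
  have "ennreal (c powr P * m) = (\<integral>\<^sup>+x. ennreal (c powr P) * indicator S x \<partial>M)"
    using m by (simp add: nn_integral_cmult ennreal_mult)
  also have "\<dots> \<le> (\<integral>\<^sup>+x. ennreal_powr (f x) P \<partial>M)"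
  proof (intro nn_integral_mono)
    fix x
    show "ennreal (c powr P) * indicator S x \<le> ennreal_powr (f x) P"
      using ennreal_powr_mono[OF f, of x P] P by (auto simp: indicator_def ennreal_powr_ennreal c)
  qed
  finally have "ennreal_powr (ennreal (c powr P * m)) (1 / P) \<le> ennreal_powr (\<integral>\<^sup>+x. ennreal_powr (f x) P \<partial>M) (1 / P)"
    using P by (intro ennreal_powr_mono) auto
  moreover have "(c powr P * m) powr (1 / P) = c * m powr (1 / P)"
    using P c m by (simp add: powr_mult powr_powr)
  ultimately show ?thesis
    using P m c unfolding eq by (simp add: Lnorm_def real ennreal_powr_ennreal)
next
  case MInf then show ?thesis using p by simp
qed

lemma mixed_norm_ge:
  assumes qr: "1 \<le> q" "1 \<le> r" and "0 < \<tau>" "0 < m" "0 \<le> c"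
    and S: "\<And>t. \<bar>t\<bar> \<le> \<tau> \<Longrightarrow> S t \<in> sets (Leb d)" "\<And>t. \<bar>t\<bar> \<le> \<tau> \<Longrightarrow> emeasure (Leb d) (S t) = ennreal m"
    and F: "\<And>t x. \<bar>t\<bar> \<le> \<tau> \<Longrightarrow> x \<in> S t \<Longrightarrow> c \<le> norm (F t x)"
  shows "ennreal (c * m powr real_of_ereal (1 / r) * (2 * \<tau>) powr real_of_ereal (1 / q)) \<le> mixed_norm d q r F"
  unfolding mixed_norm_def
proof (rule Lnorm_ge)
  show "emeasure lborel {-\<tau>..\<tau>} = ennreal (2 * \<tau>)" using assms by simp
  fix t assume "t \<in> {-\<tau>..\<tau>}"
  then have t: "\<bar>t\<bar> \<le> \<tau>" by auto
  show "ennreal (c * m powr real_of_ereal (1 / r)) \<le> Lnorm (Leb d) r (\<lambda>x. ennreal (norm (F t x)))"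
    by (rule Lnorm_ge[OF qr(2) S[OF t]]) (use assms F[OF t] in \<open>auto intro: ennreal_leI\<close>)
qed (use assms in auto)

section \<open>Wave packets over cross polytopes\<close>

lemma space_Leb: "space (Leb d) = (\<Pi>\<^sub>E i\<in>{..<d}. UNIV)"
  by (simp add: Leb_def space_PiM)

lemma box_Leb:
  assumes "\<And>i. i < d \<Longrightarrow> l i \<le> u i"
  shows "(\<Pi>\<^sub>E i\<in>{..<d}. {l i..u i}) \<in> sets (Leb d)"
    and "emeasure (Leb d) (\<Pi>\<^sub>E i\<in>{..<d}. {l i..u i}) = ennreal (\<Prod>i<d. u i - l i)"
proof -
  show "(\<Pi>\<^sub>E i\<in>{..<d}. {l i..u i}) \<in> sets (Leb d)"
    unfolding Leb_def by (intro sets_PiM_I_finite) auto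
  have "emeasure (Leb d) (\<Pi>\<^sub>E i\<in>{..<d}. {l i..u i}) = (\<Prod>i<d. emeasure lborel {l i..u i})"
    unfolding Leb_def by (intro lborel_prod.emeasure_PiM) auto
  also have "\<dots> = (\<Prod>i<d. ennreal (u i - l i))"
    using assms by (intro prod.cong) auto
  finally show "emeasure (Leb d) (\<Pi>\<^sub>E i\<in>{..<d}. {l i..u i}) = ennreal (\<Prod>i<d. u i - l i)"
    using assms by (subst prod_ennreal[symmetric]) auto
qed

lemma L2_set_diff_le:
  fixes d :: nat
  shows "\<bar>L2_set \<xi> {..<d} - L2_set \<eta> {..<d}\<bar> \<le> (\<Sum>i<d. \<bar>\<xi> i - \<eta> i\<bar>)"
proof -
  have le: "L2_set \<xi> {..<d} - L2_set \<eta> {..<d} \<le> (\<Sum>i<d. \<bar>\<xi> i - \<eta> i\<bar>)" for \<xi> \<eta> :: "nat \<Rightarrow> real"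
  proof -
    have "L2_set (\<lambda>i. \<eta> i + (\<xi> i - \<eta> i)) {..<d} \<le> L2_set \<eta> {..<d} + L2_set (\<lambda>i. \<xi> i - \<eta> i) {..<d}"
      by (rule L2_set_triangle_ineq)
    then show ?thesis using L2_set_le_sum_abs[of "\<lambda>i. \<xi> i - \<eta> i" "{..<d}"] by simp
  qed
  show ?thesis using le[of \<xi> \<eta>] le[of \<eta> \<xi>] by (simp add: abs_minus_commute abs_le_iff)
qed

lemma L2_set_measurable [measurable]: "(\<lambda>\<xi>. L2_set \<xi> {..<d}) \<in> borel_measurable (Leb d)"
  unfolding L2_set_def by measurable

text \<open>The data in frequency space are tents over cross polytopes (unit balls of a weighted
  \<open>l\<^sup>1\<close> norm with semi-axes \<open>w i\<close>). With this norm a bump of widths at most \<open>\<rho>\<close> lies within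
  distance \<open>\<rho>\<close> of its centre whatever the dimension is, and tents are Lipschitz functions by inspection.\<close>

definition weighted_dist :: "nat \<Rightarrow> (nat \<Rightarrow> real) \<Rightarrow> (nat \<Rightarrow> real) \<Rightarrow> (nat \<Rightarrow> real) \<Rightarrow> real" where
  "weighted_dist d a w \<xi> = (\<Sum>i<d. \<bar>\<xi> i - a i\<bar> / w i)"

definition tent :: "nat \<Rightarrow> (nat \<Rightarrow> real) \<Rightarrow> (nat \<Rightarrow> real) \<Rightarrow> (nat \<Rightarrow> real) \<Rightarrow> real" where
  "tent d a w \<xi> = max 0 (1 - weighted_dist d a w \<xi>)"

definition cross_polytope :: "nat \<Rightarrow> (nat \<Rightarrow> real) \<Rightarrow> (nat \<Rightarrow> real) \<Rightarrow> (nat \<Rightarrow> real) set" where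
  "cross_polytope d a w = {\<xi> \<in> space (Leb d). weighted_dist d a w \<xi> \<le> 1}"

definition packet ::
    "nat \<Rightarrow> (nat \<Rightarrow> real) \<Rightarrow> (nat \<Rightarrow> real) \<Rightarrow> ((nat \<Rightarrow> real) \<Rightarrow> real) \<Rightarrow> (nat \<Rightarrow> real) \<Rightarrow> complex" where
  "packet d a w \<theta> \<xi> = cis (\<theta> \<xi>) * complex_of_real (tent d a w \<xi>)"

lemma weighted_dist_measurable [measurable]: "weighted_dist d a w \<in> borel_measurable (Leb d)"
  unfolding weighted_dist_def by measurable

lemma tent_measurable [measurable]: "tent d a w \<in> borel_measurable (Leb d)"
  unfolding tent_def by measurable

lemma cross_polytope_measurable [measurable]: "cross_polytope d a w \<in> sets (Leb d)"
  unfolding cross_polytope_def by measurable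

lemma norm_cis_diff_le: "norm (cis x - cis y) \<le> \<bar>x - y\<bar>"
proof -
  have "cis x - cis y = cis y * (exp (\<i> * complex_of_real (x - y)) - 1)"
    by (simp add: cis_conv_exp right_diff_distrib flip: exp_add)
  then have "norm (cis x - cis y) = 2 * \<bar>sin ((x - y) / 2)\<bar>"
    by (simp only: norm_mult norm_cis dist_exp_i_1 mult_1)
  also have "\<dots> \<le> \<bar>x - y\<bar>"
    using abs_sin_le_one abs_sin_x_le_abs_x[of "(x - y) / 2"] by simp
  finally show ?thesis .
qed

locale tent_box =
  fixes d :: nat and a w :: "nat \<Rightarrow> real"
  assumes w_pos: "\<And>i. i < d \<Longrightarrow> 0 < w i"
begin

lemma weighted_dist_nonneg: "0 \<le> weighted_dist d a w \<xi>"
  unfolding weighted_dist_def by (intro sum_nonneg divide_nonneg_pos w_pos) auto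

lemma tent_range: "0 \<le> tent d a w \<xi>" "tent d a w \<xi> \<le> 1"
  using weighted_dist_nonneg by (auto simp: tent_def)

lemma coord_le_of_cross_polytope:
  assumes "weighted_dist d a w \<xi> \<le> 1" "i < d"
  shows "\<bar>\<xi> i - a i\<bar> \<le> w i"
proof -
  have "\<bar>\<xi> i - a i\<bar> / w i \<le> weighted_dist d a w \<xi>"
    unfolding weighted_dist_def
    using assms(2) w_pos by (intro member_le_sum) (auto intro: divide_nonneg_pos)
  then show ?thesis using assms w_pos[OF assms(2)] by (simp add: pos_divide_le_eq order_trans)
qed

lemma sum_abs_diff_le_of_cross_polytope:
  assumes "weighted_dist d a w \<xi> \<le> 1" "I \<subseteq> {..<d}" "\<And>i. i \<in> I \<Longrightarrow> w i \<le> \<rho>" "0 \<le> \<rho>"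
  shows "(\<Sum>i\<in>I. \<bar>\<xi> i - a i\<bar>) \<le> \<rho>"
proof -
  have "(\<Sum>i\<in>I. \<bar>\<xi> i - a i\<bar>) \<le> (\<Sum>i\<in>I. \<rho> * (\<bar>\<xi> i - a i\<bar> / w i))"
  proof (intro sum_mono)
    fix i assume i: "i \<in> I"
    then have "0 < w i" using assms(2) w_pos by auto
    moreover have "w i * \<bar>\<xi> i - a i\<bar> \<le> \<rho> * \<bar>\<xi> i - a i\<bar>"
      using assms(3)[OF i] by (intro mult_right_mono) auto
    ultimately show "\<bar>\<xi> i - a i\<bar> \<le> \<rho> * (\<bar>\<xi> i - a i\<bar> / w i)"
      by (simp add: field_simps)
  qed
  also have "\<dots> \<le> (\<Sum>i<d. \<rho> * (\<bar>\<xi> i - a i\<bar> / w i))"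
    using assms w_pos by (intro sum_mono2) (auto intro!: mult_nonneg_nonneg divide_nonneg_pos)
  also have "\<dots> = \<rho> * weighted_dist d a w \<xi>"
    by (simp add: weighted_dist_def sum_distrib_left)
  also have "\<dots> \<le> \<rho>" using assms by (simp add: mult_left_le)
  finally show ?thesis .
qed

lemma tent_lipschitz:
  "\<bar>tent d a w \<xi> - tent d a w \<eta>\<bar> \<le> (\<Sum>i<d. 1 / w i) * (\<Sum>i<d. \<bar>\<xi> i - \<eta> i\<bar>)"
proof -
  have "\<bar>tent d a w \<xi> - tent d a w \<eta>\<bar> \<le> \<bar>weighted_dist d a w \<xi> - weighted_dist d a w \<eta>\<bar>"
    by (auto simp: tent_def max_def)
  also have "\<dots> = \<bar>\<Sum>i<d. (\<bar>\<xi> i - a i\<bar> - \<bar>\<eta> i - a i\<bar>) / w i\<bar>"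
    by (simp add: weighted_dist_def sum_subtractf diff_divide_distrib)
  also have "\<dots> \<le> (\<Sum>i<d. \<bar>(\<bar>\<xi> i - a i\<bar> - \<bar>\<eta> i - a i\<bar>) / w i\<bar>)"
    by (rule sum_abs)
  also have "\<dots> \<le> (\<Sum>i<d. (\<Sum>j<d. 1 / w j) * \<bar>\<xi> i - \<eta> i\<bar>)"
  proof (intro sum_mono)
    fix i assume i: "i \<in> {..<d}"
    then have "0 < w i" using w_pos by auto
    then have "\<bar>(\<bar>\<xi> i - a i\<bar> - \<bar>\<eta> i - a i\<bar>) / w i\<bar> \<le> (1 / w i) * \<bar>\<xi> i - \<eta> i\<bar>"
      by (auto simp: divide_right_mono)
    also have "\<dots> \<le> (\<Sum>j<d. 1 / w j) * \<bar>\<xi> i - \<eta> i\<bar>"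
      using i w_pos by (intro mult_right_mono member_le_sum) (auto intro: less_imp_le)
    finally show "\<bar>(\<bar>\<xi> i - a i\<bar> - \<bar>\<eta> i - a i\<bar>) / w i\<bar> \<le> (\<Sum>j<d. 1 / w j) * \<bar>\<xi> i - \<eta> i\<bar>" .
  qed
  finally show ?thesis by (simp add: sum_distrib_left)
qed

lemma emeasure_cross_polytope_le: "emeasure (Leb d) (cross_polytope d a w) \<le> ennreal (\<Prod>i<d. 2 * w i)"
proof -
  have "cross_polytope d a w \<subseteq> (\<Pi>\<^sub>E i\<in>{..<d}. {a i - w i..a i + w i})"
  proof
    fix \<xi> assume "\<xi> \<in> cross_polytope d a w"
    then have \<xi>: "\<xi> \<in> extensional {..<d}" "weighted_dist d a w \<xi> \<le> 1"
      by (auto simp: cross_polytope_def space_Leb PiE_def)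
    have "\<xi> i \<in> {a i - w i..a i + w i}" if "i < d" for i
      using coord_le_of_cross_polytope[OF \<xi>(2) that] by (auto simp: abs_le_iff)
    then show "\<xi> \<in> (\<Pi>\<^sub>E i\<in>{..<d}. {a i - w i..a i + w i})"
      using \<xi>(1) by (auto simp: PiE_def)
  qed
  then have "emeasure (Leb d) (cross_polytope d a w) \<le> emeasure (Leb d) (\<Pi>\<^sub>E i\<in>{..<d}. {a i - w i..a i + w i})"
    using w_pos by (intro emeasure_mono box_Leb) (auto intro: less_imp_le)
  also have "\<dots> = ennreal (\<Prod>i<d. 2 * w i)"
    using w_pos by (subst box_Leb) (auto intro: less_imp_le)
  finally show ?thesis .
qed

lemma measure_cross_polytope_le: "measure (Leb d) (cross_polytope d a w) \<le> (\<Prod>i<d. 2 * w i)"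
  unfolding measure_def using emeasure_cross_polytope_le w_pos
  by (intro enn2real_leI prod_nonneg) (auto intro: less_imp_le)

lemma packet_datum:
  assumes [measurable]: "\<theta> \<in> borel_measurable (Leb d)"
  shows "fourier_datum d (packet d a w \<theta>) (cross_polytope d a w)"
proof
  show "packet d a w \<theta> \<in> borel_measurable (Leb d)"
    unfolding packet_def by measurable
  show "emeasure (Leb d) (cross_polytope d a w) < \<infinity>"
    using le_less_trans[OF emeasure_cross_polytope_le] by auto
  show "norm (packet d a w \<theta> \<xi>) \<le> 1" for \<xi>
    using tent_range[of \<xi>] by (simp add: packet_def norm_mult)
  show "packet d a w \<theta> \<xi> = 0" if "\<xi> \<in> space (Leb d)" "\<xi> \<notin> cross_polytope d a w" for \<xi>
    using that by (simp add: packet_def cross_polytope_def tent_def)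
qed simp

text \<open>Multiplying the tent by a phase keeps the Lipschitz condition if the phase function is Lipschitz
  where the tent is nonzero. The condition is imposed there only, since \<open>\<bar>\<xi>\<bar>\<^sup>2\<close> is not Lipschitz globally.\<close>

lemma has_fourier_packet:
  assumes [measurable]: "\<theta> \<in> borel_measurable (Leb d)" and M: "0 \<le> M"
    and \<theta>: "\<And>\<xi> \<eta>. weighted_dist d a w \<xi> \<le> 1 \<Longrightarrow> weighted_dist d a w \<eta> \<le> 1 \<Longrightarrow>
               \<bar>\<theta> \<xi> - \<theta> \<eta>\<bar> \<le> M * (\<Sum>i<d. \<bar>\<xi> i - \<eta> i\<bar>)"
  shows "has_fourier d (inv_fourier d (packet d a w \<theta>)) (packet d a w \<theta>)"
proof -
  interpret fourier_datum d "packet d a w \<theta>" "cross_polytope d a w"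
    by (rule packet_datum) simp
  let ?W = "\<Sum>i<d. 1 / w i"
  show ?thesis
  proof (rule has_fourier_inv_fourier)
    have W: "0 \<le> ?W" using w_pos by (intro sum_nonneg) (auto intro: less_imp_le)
    then show "0 \<le> M + ?W" using M by simp
    fix \<xi> \<eta> :: "nat \<Rightarrow> real" assume "\<xi> \<in> cross_polytope d a w"
    then have \<xi>: "weighted_dist d a w \<xi> \<le> 1" by (simp add: cross_polytope_def)
    let ?D = "\<Sum>i<d. \<bar>\<xi> i - \<eta> i\<bar>"
    have D: "0 \<le> ?D" by (intro sum_nonneg) auto
    have "packet d a w \<theta> \<xi> - packet d a w \<theta> \<eta> = cis (\<theta> \<xi>) * complex_of_real (tent d a w \<xi> - tent d a w \<eta>)
        + (cis (\<theta> \<xi>) - cis (\<theta> \<eta>)) * complex_of_real (tent d a w \<eta>)"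
      by (simp add: packet_def algebra_simps)
    then have "norm (packet d a w \<theta> \<xi> - packet d a w \<theta> \<eta>)
        \<le> norm (cis (\<theta> \<xi>) * complex_of_real (tent d a w \<xi> - tent d a w \<eta>))
          + norm ((cis (\<theta> \<xi>) - cis (\<theta> \<eta>)) * complex_of_real (tent d a w \<eta>))"
      by (simp only: norm_triangle_ineq)
    also have "\<dots> = \<bar>tent d a w \<xi> - tent d a w \<eta>\<bar> + norm (cis (\<theta> \<xi>) - cis (\<theta> \<eta>)) * tent d a w \<eta>"
      using tent_range(1)[of \<eta>] by (simp only: norm_mult norm_of_real) simp
    also have "norm (cis (\<theta> \<xi>) - cis (\<theta> \<eta>)) * tent d a w \<eta> \<le> M * ?D"
    proof (cases "weighted_dist d a w \<eta> \<le> 1")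
      case True
      have "norm (cis (\<theta> \<xi>) - cis (\<theta> \<eta>)) * tent d a w \<eta> \<le> norm (cis (\<theta> \<xi>) - cis (\<theta> \<eta>))"
        using tent_range[of \<eta>] by (intro mult_left_le) auto
      also have "\<dots> \<le> \<bar>\<theta> \<xi> - \<theta> \<eta>\<bar>" by (rule norm_cis_diff_le)
      also have "\<dots> \<le> M * ?D" by (rule \<theta>[OF \<xi> True])
      finally show ?thesis .
    next
      case False
      then show ?thesis using M D by (simp add: tent_def)
    qed
    finally show "norm (packet d a w \<theta> \<xi> - packet d a w \<theta> \<eta>) \<le> (M + ?W) * ?D"
      using tent_lipschitz[of \<xi> \<eta>] by (simp add: algebra_simps)
  qed
qed

text \<open>The tent is at least \<open>1 / 2\<close> on the box with half-widths \<open>w i / (2 d)\<close>, which lies in the cross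
  polytope scaled by \<open>1 / 2\<close>.\<close>

lemma integral_tent_ge:
  assumes d: "0 < d"
  shows "integrable (Leb d) (tent d a w)"
    and "(\<Prod>i<d. w i / real d) / 2 \<le> (LINT \<xi>|Leb d. tent d a w \<xi>)"
proof -
  interpret fourier_datum d "packet d a w (\<lambda>_. 0)" "cross_polytope d a w"
    by (rule packet_datum) simp
  show I: "integrable (Leb d) (tent d a w)"
    using integrable_H by (simp add: packet_def[abs_def] complex_of_real_integrable_eq)
  define B where "B = (\<Pi>\<^sub>E i\<in>{..<d}. {a i - w i / (2 * real d)..a i + w i / (2 * real d)})"
  have le: "a i - w i / (2 * real d) \<le> a i + w i / (2 * real d)" if "i < d" for i
    using w_pos[OF that] by simp
  have B [measurable]: "B \<in> sets (Leb d)"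
    unfolding B_def by (rule box_Leb[OF le])
  have vol: "emeasure (Leb d) B = ennreal (\<Prod>i<d. w i / real d)"
    unfolding B_def by (subst box_Leb[OF le]) auto
  have ge: "1 / 2 * indicator B \<xi> \<le> tent d a w \<xi>" for \<xi>
  proof (cases "\<xi> \<in> B")
    case True
    have "weighted_dist d a w \<xi> \<le> (\<Sum>i<d. 1 / (2 * real d))"
      unfolding weighted_dist_def
    proof (intro sum_mono)
      fix i assume i: "i \<in> {..<d}"
      then have "\<xi> i \<in> {a i - w i / (2 * real d)..a i + w i / (2 * real d)}"
        using True by (auto simp: B_def PiE_def)
      then have "\<bar>\<xi> i - a i\<bar> \<le> w i / (2 * real d)" by (auto simp: abs_le_iff)
      then show "\<bar>\<xi> i - a i\<bar> / w i \<le> 1 / (2 * real d)"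
        using w_pos[of i] i by (simp add: pos_divide_le_eq)
    qed
    also have "\<dots> = 1 / 2" using d by simp
    finally show ?thesis using True by (simp add: tent_def)
  qed (use tent_range in auto)
  have P: "0 \<le> (\<Prod>i<d. w i / real d)" using w_pos by (intro prod_nonneg) (auto intro: less_imp_le)
  have "(\<Prod>i<d. w i / real d) / 2 = (LINT \<xi>|Leb d. 1 / 2 * indicator B \<xi>)"
    using vol P by (simp add: measure_def sets.Int_space_eq2)
  also have "\<dots> \<le> (LINT \<xi>|Leb d. tent d a w \<xi>)"
    by (intro integral_mono I ge integrable_mult_right integrable_real_indicator) (auto simp: vol)
  finally show "(\<Prod>i<d. w i / real d) / 2 \<le> (LINT \<xi>|Leb d. tent d a w \<xi>)" .
qed

text \<open>After the constant factor \<open>cis \<kappa>\<close> is taken out, the real part of the integrand is at least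
  \<open>cos 1 \<ge> cos (pi / 3) = 1 / 2\<close> times the tent, so nothing cancels.\<close>

lemma inv_fourier_packet_ge:
  assumes d: "0 < d" and [measurable]: "\<theta> \<in> borel_measurable (Leb d)"
    and phase: "\<And>\<xi>. weighted_dist d a w \<xi> \<le> 1 \<Longrightarrow> \<bar>(\<Sum>i<d. x i * \<xi> i) + \<theta> \<xi> - \<kappa>\<bar> \<le> 1"
  shows "(\<Prod>i<d. w i / real d) / (4 * (2 * pi) ^ d) \<le> norm (inv_fourier d (packet d a w \<theta>) x)"
proof -
  interpret fourier_datum d "packet d a w \<theta>" "cross_polytope d a w"
    by (rule packet_datum) simp
  let ?F = "\<lambda>\<xi>. cis ((\<Sum>i<d. x i * \<xi> i) + \<theta> \<xi> - \<kappa>) * complex_of_real (tent d a w \<xi>)"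
  have I: "integrable (Leb d) ?F"
    by (rule Bochner_Integration.integrable_bound[OF integral_tent_ge(1)[OF d]])
       (auto simp: norm_mult)
  have "(LINT \<xi>|Leb d. cis (\<Sum>i<d. x i * \<xi> i) * packet d a w \<theta> \<xi>) = cis \<kappa> * (LINT \<xi>|Leb d. ?F \<xi>)"
    by (simp add: packet_def cis_mult flip: mult.assoc integral_mult_right_zero)
  then have norm_eq: "norm (inv_fourier d (packet d a w \<theta>) x) = norm (LINT \<xi>|Leb d. ?F \<xi>) / (2 * pi) ^ d"
    unfolding inv_fourier_def by (simp only: norm_mult norm_of_real norm_cis) simp
  have "(1 / 2) * ((\<Prod>i<d. w i / real d) / 2) \<le> (1 / 2) * (LINT \<xi>|Leb d. tent d a w \<xi>)"
    by (intro mult_left_mono integral_tent_ge d) auto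
  also have "\<dots> = (LINT \<xi>|Leb d. 1 / 2 * tent d a w \<xi>)" by simp
  also have "\<dots> \<le> (LINT \<xi>|Leb d. Re (?F \<xi>))"
  proof (intro integral_mono)
    fix \<xi>
    show "1 / 2 * tent d a w \<xi> \<le> Re (?F \<xi>)"
    proof (cases "weighted_dist d a w \<xi> \<le> 1")
      case True
      let ?p = "(\<Sum>i<d. x i * \<xi> i) + \<theta> \<xi> - \<kappa>"
      have "cos (pi / 3) \<le> cos \<bar>?p\<bar>"
        using phase[OF True] pi_gt3 by (intro cos_monotone_0_pi_le) auto
      then have "1 / 2 \<le> cos ?p" by (simp only: cos_60 cos_abs_real)
      then have "1 / 2 * tent d a w \<xi> \<le> cos ?p * tent d a w \<xi>"
        by (intro mult_right_mono tent_range)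
      then show ?thesis by simp
    qed (simp add: tent_def)
  qed (use integral_tent_ge(1)[OF d] integrable_Re[OF I] in simp_all)
  also have "\<dots> = Re (LINT \<xi>|Leb d. ?F \<xi>)"
    by (rule integral_Re[OF I])
  also have "\<dots> \<le> norm (LINT \<xi>|Leb d. ?F \<xi>)" by (rule complex_Re_le_cmod)
  finally show ?thesis unfolding norm_eq by (simp add: field_simps)
qed

lemma L2norm_packet_le:
  assumes [measurable]: "\<theta> \<in> borel_measurable (Leb d)"
  shows "L2norm d (inv_fourier d (packet d a w \<theta>)) \<le> ennreal (sqrt (\<Prod>i<d. 2 * w i))"
proof -
  interpret fourier_datum d "packet d a w \<theta>" "cross_polytope d a w"
    by (rule packet_datum) simp
  show ?thesis
    using L2norm_inv_fourier_le measure_cross_polytope_le by (meson ennreal_leI order_trans real_sqrt_le_mono)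
qed

lemma L2_set_le_of_cross_polytope:
  assumes \<xi>: "weighted_dist d a w \<xi> \<le> 1" and w: "\<And>i. i < d \<Longrightarrow> w i \<le> \<rho>" and "0 \<le> \<rho>"
  shows "L2_set \<xi> {..<d} \<le> L2_set a {..<d} + \<rho>"
  using L2_set_diff_le[of \<xi> d a] sum_abs_diff_le_of_cross_polytope[OF \<xi> subset_refl, of \<rho>] assms by simp

lemma is_multiplier_image_packet:
  assumes "\<theta> \<in> borel_measurable (Leb d)" and "0 \<le> M"
    and "\<And>\<xi> \<eta>. weighted_dist d a w \<xi> \<le> 1 \<Longrightarrow> weighted_dist d a w \<eta> \<le> 1 \<Longrightarrow>
               \<bar>\<theta> \<xi> - \<theta> \<eta>\<bar> \<le> M * (\<Sum>i<d. \<bar>\<xi> i - \<eta> i\<bar>)"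
  shows "is_multiplier_image d (\<lambda>\<xi>. cis (\<theta> \<xi>)) (inv_fourier d (packet d a w (\<lambda>_. 0)))
           (inv_fourier d (packet d a w \<theta>))"
proof -
  have "has_fourier d (inv_fourier d (packet d a w \<theta>)) (packet d a w \<theta>)"
    by (rule has_fourier_packet) fact+
  moreover have "packet d a w \<theta> = (\<lambda>\<xi>. cis (\<theta> \<xi>) * packet d a w (\<lambda>_. 0) \<xi>)"
    by (simp add: packet_def fun_eq_iff)
  moreover have "has_fourier d (inv_fourier d (packet d a w (\<lambda>_. 0))) (packet d a w (\<lambda>_. 0))"
    by (rule has_fourier_packet[of _ 0]) auto
  ultimately show ?thesis
    unfolding is_multiplier_image_def by metis
qed

lemma wave_evolution_packet:
  "wave_evolution d (inv_fourier d (packet d a w (\<lambda>_. 0)))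
     (\<lambda>t. inv_fourier d (packet d a w (\<lambda>\<xi>. t * L2_set \<xi> {..<d})))"
  unfolding wave_evolution_def
proof
  fix t :: real
  show "is_multiplier_image d (\<lambda>\<xi>. cis (t * L2_set \<xi> {..<d})) (inv_fourier d (packet d a w (\<lambda>_. 0)))
      (inv_fourier d (packet d a w (\<lambda>\<xi>. t * L2_set \<xi> {..<d})))"
  proof (rule is_multiplier_image_packet[of _ "\<bar>t\<bar>"])
    show "\<bar>t * L2_set \<xi> {..<d} - t * L2_set \<eta> {..<d}\<bar> \<le> \<bar>t\<bar> * (\<Sum>i<d. \<bar>\<xi> i - \<eta> i\<bar>)" for \<xi> \<eta>
      unfolding right_diff_distrib[symmetric] abs_mult by (intro mult_left_mono L2_set_diff_le) auto
  qed auto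
qed

text \<open>On the bounded support of the tent the symbol \<open>\<bar>\<xi>\<bar>\<^sup>2\<close> is Lipschitz with constant twice the
  radius.\<close>

lemma schroedinger_evolution_packet:
  "schroedinger_evolution d (inv_fourier d (packet d a w (\<lambda>_. 0)))
     (\<lambda>t. inv_fourier d (packet d a w (\<lambda>\<xi>. - t * (L2_set \<xi> {..<d})\<^sup>2)))"
  unfolding schroedinger_evolution_def
proof
  fix t :: real
  define \<rho> where "\<rho> = (\<Sum>i<d. w i)"
  define R where "R = L2_set a {..<d} + \<rho>"
  have w_le: "w i \<le> \<rho>" if "i < d" for i
    unfolding \<rho>_def using that w_pos by (intro member_le_sum) (auto intro: less_imp_le)
  have \<rho>: "0 \<le> \<rho>" unfolding \<rho>_def using w_pos by (intro sum_nonneg) (auto intro: less_imp_le)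
  then have R: "0 \<le> R" by (simp add: R_def)
  show "is_multiplier_image d (\<lambda>\<xi>. cis (- t * (L2_set \<xi> {..<d})\<^sup>2)) (inv_fourier d (packet d a w (\<lambda>_. 0)))
      (inv_fourier d (packet d a w (\<lambda>\<xi>. - t * (L2_set \<xi> {..<d})\<^sup>2)))"
  proof (rule is_multiplier_image_packet[of _ "\<bar>t\<bar> * (2 * R)"])
    fix \<xi> \<eta> assume \<xi>\<eta>: "weighted_dist d a w \<xi> \<le> 1" "weighted_dist d a w \<eta> \<le> 1"
    let ?a = "L2_set \<xi> {..<d}" and ?b = "L2_set \<eta> {..<d}"
    have "?a \<le> R" "?b \<le> R"
      unfolding R_def using L2_set_le_of_cross_polytope[OF _ w_le \<rho>] \<xi>\<eta> by auto
    then have "\<bar>?a + ?b\<bar> \<le> 2 * R"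
      using L2_set_nonneg[of \<xi> "{..<d}"] L2_set_nonneg[of \<eta> "{..<d}"] by linarith
    then have "\<bar>?a + ?b\<bar> * \<bar>?a - ?b\<bar> \<le> 2 * R * (\<Sum>i<d. \<bar>\<xi> i - \<eta> i\<bar>)"
      using R by (intro mult_mono L2_set_diff_le) auto
    then have "\<bar>t\<bar> * (\<bar>?a + ?b\<bar> * \<bar>?a - ?b\<bar>) \<le> \<bar>t\<bar> * (2 * R * (\<Sum>i<d. \<bar>\<xi> i - \<eta> i\<bar>))"
      by (rule mult_left_mono) simp
    moreover have "\<bar>- t * ?a\<^sup>2 - - t * ?b\<^sup>2\<bar> = \<bar>t\<bar> * (\<bar>?a + ?b\<bar> * \<bar>?a - ?b\<bar>)"
    proof -
      have "- t * ?a\<^sup>2 - - t * ?b\<^sup>2 = (- t) * ((?a + ?b) * (?a - ?b))"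
        by (simp add: power2_eq_square algebra_simps)
      then show ?thesis by (simp only: abs_mult abs_minus_cancel)
    qed
    ultimately show "\<bar>- t * ?a\<^sup>2 - - t * ?b\<^sup>2\<bar> \<le> \<bar>t\<bar> * (2 * R) * (\<Sum>i<d. \<bar>\<xi> i - \<eta> i\<bar>)"
      by (simp add: mult.assoc)
  qed (use R in auto)
qed

lemma fourier_supp_annulus_packet:
  assumes "\<And>\<xi>. weighted_dist d a w \<xi> \<le> 1 \<Longrightarrow> 1 / A \<le> L2_set \<xi> {..<d} \<and> L2_set \<xi> {..<d} \<le> A"
  shows "fourier_supp_annulus d A (inv_fourier d (packet d a w (\<lambda>_. 0)))"
  unfolding fourier_supp_annulus_def
proof (intro exI conjI)
  show "has_fourier d (inv_fourier d (packet d a w (\<lambda>_. 0))) (packet d a w (\<lambda>_. 0))"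
    by (rule has_fourier_packet[of _ 0]) auto
  show "AE \<xi> in Leb d. \<not> (1 / A \<le> L2_set \<xi> {..<d} \<and> L2_set \<xi> {..<d} \<le> A) \<longrightarrow> packet d a w (\<lambda>_. 0) \<xi> = 0"
  proof (intro AE_I2 impI)
    fix \<xi> assume "\<not> (1 / A \<le> L2_set \<xi> {..<d} \<and> L2_set \<xi> {..<d} \<le> A)"
    then have "\<not> weighted_dist d a w \<xi> \<le> 1" using assms by blast
    then show "packet d a w (\<lambda>_. 0) \<xi> = 0" by (simp add: packet_def tent_def)
  qed
qed

lemma inv_fourier_packet_in_L2: "inv_fourier d (packet d a w (\<lambda>_. 0)) \<in> L2 d"
proof -
  interpret fourier_datum d "packet d a w (\<lambda>_. 0)" "cross_polytope d a w"
    by (rule packet_datum) simp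
  show ?thesis by (rule inv_fourier_in_L2)
qed

text \<open>The pairing of a weighted \<open>l\<^sup>1\<close> norm with its dual norm, a weighted maximum.\<close>

lemma linear_phase_le:
  assumes \<xi>: "weighted_dist d a w \<xi> \<le> 1" and y: "\<And>i. i < d \<Longrightarrow> \<bar>y i\<bar> * w i \<le> c" and c: "0 \<le> c"
  shows "\<bar>\<Sum>i<d. y i * (\<xi> i - a i)\<bar> \<le> c"
proof -
  have "\<bar>\<Sum>i<d. y i * (\<xi> i - a i)\<bar> \<le> (\<Sum>i<d. \<bar>y i * (\<xi> i - a i)\<bar>)"
    by (rule sum_abs)
  also have "\<dots> \<le> (\<Sum>i<d. c * (\<bar>\<xi> i - a i\<bar> / w i))"
  proof (rule sum_mono)
    fix i assume "i \<in> {..<d}"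
    then have "0 < w i" "\<bar>y i\<bar> * w i \<le> c" using w_pos y by auto
    then have "\<bar>y i\<bar> * w i * (\<bar>\<xi> i - a i\<bar> / w i) \<le> c * (\<bar>\<xi> i - a i\<bar> / w i)"
      by (intro mult_right_mono) auto
    then show "\<bar>y i * (\<xi> i - a i)\<bar> \<le> c * (\<bar>\<xi> i - a i\<bar> / w i)"
      using \<open>0 < w i\<close> by (simp add: abs_mult)
  qed
  also have "\<dots> = c * weighted_dist d a w \<xi>"
    by (simp add: weighted_dist_def sum_distrib_left)
  also have "\<dots> \<le> c" using \<xi> c by (simp add: mult_left_le)
  finally show ?thesis .
qed

end

section \<open>Two packets travelling in a common tube\<close>

lemma sum_lessThan_head: "0 < (d::nat) \<Longrightarrow> (\<Sum>i<d. f i) = f 0 + (\<Sum>i\<in>{1..<d}. f i :: real)"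
  using sum.atLeast_Suc_lessThan[of 0 d f] by (simp add: atLeast0LessThan)

lemma prod_lessThan_head: "0 < (d::nat) \<Longrightarrow> (\<Prod>i<d. f i) = f 0 * (\<Prod>i\<in>{1..<d}. f i :: real)"
  using prod.atLeast_Suc_lessThan[of 0 d f] by (simp add: atLeast0LessThan)

lemma sum_squares_le_square_sum_abs: "(\<Sum>i\<in>I. (f i)\<^sup>2) \<le> (\<Sum>i\<in>I. \<bar>f i :: real\<bar>)\<^sup>2"
proof -
  have "(\<Sum>i\<in>I. (f i)\<^sup>2) = (L2_set f I)\<^sup>2"
    by (simp add: L2_set_def sum_nonneg)
  also have "\<dots> \<le> (\<Sum>i\<in>I. \<bar>f i\<bar>)\<^sup>2"
    by (intro power_mono L2_set_le_sum_abs) simp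
  finally show ?thesis .
qed

definition wave_centre :: "nat \<Rightarrow> real" where
  "wave_centre i = (if i = 0 then 1 else 0)"

text \<open>The long side points in the direction of propagation. There the symbol \<open>\<bar>\<xi>\<bar>\<close> is linear, so the
  width need not shrink with \<open>\<delta>\<close>.\<close>

definition wave_width :: "real \<Rightarrow> nat \<Rightarrow> real" where
  "wave_width \<delta> i = (if i = 0 then 1 / 4 else \<delta>)"

text \<open>Velocity \<open>2 \<xi>\<close> at this frequency equals the velocity \<open>- \<xi> / \<bar>\<xi>\<bar>\<close> of the wave at
  \<open>wave_centre\<close>.\<close>

definition schroedinger_centre :: "nat \<Rightarrow> real" where
  "schroedinger_centre i = (if i = 0 then - 1 / 2 else 0)"

text \<open>The region at time \<open>t\<close> on which both solutions are large. It is dual to the frequency support of the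
  wave, and contained in the larger region on which the Schroedinger solution is large.\<close>

definition tube :: "nat \<Rightarrow> real \<Rightarrow> real \<Rightarrow> (nat \<Rightarrow> real) set" where
  "tube d \<delta> t = (\<Pi>\<^sub>E i\<in>{..<d}. {(if i = 0 then - t - 1 / 2 else - 1 / (2 * \<delta>))..(if i = 0 then - t + 1 / 2 else 1 / (2 * \<delta>))})"

lemma tubeD:
  assumes "x \<in> tube d \<delta> t" "i < d"
  shows "i = 0 \<Longrightarrow> \<bar>x 0 + t\<bar> \<le> 1 / 2" "i \<noteq> 0 \<Longrightarrow> \<bar>x i\<bar> \<le> 1 / (2 * \<delta>)"
proof -
  have mem: "x i \<in> {(if i = 0 then - t - 1 / 2 else - 1 / (2 * \<delta>))..(if i = 0 then - t + 1 / 2 else 1 / (2 * \<delta>))}"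
    using PiE_mem[OF assms(1)[unfolded tube_def], of i] assms(2) by simp
  show "\<bar>x 0 + t\<bar> \<le> 1 / 2" if "i = 0"
  proof (rule abs_leI)
    show "x 0 + t \<le> 1 / 2" "- (x 0 + t) \<le> 1 / 2" using mem that by simp_all
  qed
  show "\<bar>x i\<bar> \<le> 1 / (2 * \<delta>)" if "i \<noteq> 0"
    using mem that by (intro abs_leI) simp_all
qed

lemma tube_Leb:
  assumes "0 < d" "0 < \<delta>"
  shows "tube d \<delta> t \<in> sets (Leb d)" "emeasure (Leb d) (tube d \<delta> t) = ennreal ((1 / \<delta>) ^ (d - 1))"
proof -
  let ?l = "\<lambda>i::nat. if i = 0 then - t - 1 / 2 else - 1 / (2 * \<delta>)"
  let ?u = "\<lambda>i::nat. if i = 0 then - t + 1 / 2 else 1 / (2 * \<delta>)"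
  have le: "?l i \<le> ?u i" for i using assms by auto
  show "tube d \<delta> t \<in> sets (Leb d)"
    unfolding tube_def by (rule box_Leb[OF le])
  have "(\<Prod>i<d. ?u i - ?l i) = 1 * (\<Prod>i\<in>{1..<d}. 1 / \<delta>)"
    unfolding prod_lessThan_head[OF assms(1)]
    by (intro arg_cong2[where f="(*)"] prod.cong) (auto simp: field_simps)
  then show "emeasure (Leb d) (tube d \<delta> t) = ennreal ((1 / \<delta>) ^ (d - 1))"
    unfolding tube_def by (subst box_Leb[OF le]) simp
qed

context
  fixes d :: nat and \<delta> :: real
  assumes d: "2 \<le> d" and \<delta>: "0 < \<delta>" "\<delta> \<le> 1 / 4"
begin

interpretation wave: tent_box d wave_centre "wave_width \<delta>"
  by standard (use \<delta> in \<open>auto simp: wave_width_def\<close>)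

interpretation schroedinger: tent_box d schroedinger_centre "\<lambda>_. \<delta>"
  by standard (use \<delta> in auto)

lemma L2_set_wave_centre: "L2_set wave_centre {..<d} = 1"
proof -
  have "(\<Sum>i<d. (wave_centre i)\<^sup>2) = 1"
    using d by (subst sum_lessThan_head) (auto simp: wave_centre_def)
  then show ?thesis by (simp add: L2_set_def)
qed

lemma L2_set_schroedinger_centre: "L2_set schroedinger_centre {..<d} = 1 / 2"
proof -
  have "(\<Sum>i<d. (schroedinger_centre i)\<^sup>2) = (1 / 2)\<^sup>2"
    using d by (subst sum_lessThan_head) (auto simp: schroedinger_centre_def power2_eq_square)
  then show ?thesis by (simp add: L2_set_def real_sqrt_abs del: power_divide)
qed

lemma wave_in_annulus:
  assumes A: "4 \<le> A" and \<xi>: "weighted_dist d wave_centre (wave_width \<delta>) \<xi> \<le> 1"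
  shows "1 / A \<le> L2_set \<xi> {..<d} \<and> L2_set \<xi> {..<d} \<le> A"
proof -
  have "wave_width \<delta> i \<le> 1 / 4" for i
    using \<delta> by (simp add: wave_width_def)
  then have "\<bar>L2_set \<xi> {..<d} - L2_set wave_centre {..<d}\<bar> \<le> 1 / 4"
    using L2_set_diff_le[of \<xi> d wave_centre] wave.sum_abs_diff_le_of_cross_polytope[OF \<xi> subset_refl, of "1 / 4"]
    by simp
  then have "3 / 4 \<le> L2_set \<xi> {..<d}" "L2_set \<xi> {..<d} \<le> 5 / 4"
    unfolding L2_set_wave_centre by linarith+
  moreover have "1 / A \<le> 1 / 4" using A by (simp add: field_simps)
  ultimately show ?thesis using A by linarith
qed

lemma schroedinger_in_annulus:
  assumes A: "4 \<le> A" and \<xi>: "weighted_dist d schroedinger_centre (\<lambda>_. \<delta>) \<xi> \<le> 1"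
  shows "1 / A \<le> L2_set \<xi> {..<d} \<and> L2_set \<xi> {..<d} \<le> A"
proof -
  have "\<bar>L2_set \<xi> {..<d} - L2_set schroedinger_centre {..<d}\<bar> \<le> 1 / 4"
    using L2_set_diff_le[of \<xi> d schroedinger_centre] schroedinger.sum_abs_diff_le_of_cross_polytope[OF \<xi> subset_refl, of "1 / 4"] \<delta>
    by auto
  then have "1 / 4 \<le> L2_set \<xi> {..<d}" "L2_set \<xi> {..<d} \<le> 3 / 4"
    unfolding L2_set_schroedinger_centre by linarith+
  moreover have "1 / A \<le> 1 / 4" using A by (simp add: field_simps)
  ultimately show ?thesis using A by linarith
qed

lemma time_bound:
  assumes t: "\<bar>t\<bar> \<le> 1 / (2 * \<delta>\<^sup>2)" and e: "\<bar>e\<bar> \<le> \<delta>\<^sup>2"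
  shows "\<bar>t * e\<bar> \<le> 1 / 2"
proof -
  have "\<bar>t * e\<bar> \<le> 1 / (2 * \<delta>\<^sup>2) * \<delta>\<^sup>2"
    unfolding abs_mult using t e by (intro mult_mono) auto
  then show ?thesis using \<delta> by simp
qed

text \<open>Relative to the constant \<open>x\<^sub>0 + t\<close> the phase splits into a linear part, which the tube keeps
  small, and \<open>t (\<bar>\<xi>\<bar> - \<xi>\<^sub>0)\<close>. The difference of squares
  \<open>\<bar>\<xi>\<bar>\<^sup>2 - \<xi>\<^sub>0\<^sup>2\<close> consists of the short directions alone and is at most \<open>\<delta>\<^sup>2\<close>; dividing by
  \<open>\<bar>\<xi>\<bar> + \<xi>\<^sub>0 \<ge> 1\<close> bounds the second part.\<close>

lemma wave_phase:
  assumes t: "\<bar>t\<bar> \<le> 1 / (2 * \<delta>\<^sup>2)" and x: "x \<in> tube d \<delta> t"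
    and \<xi>: "weighted_dist d wave_centre (wave_width \<delta>) \<xi> \<le> 1"
  shows "\<bar>(\<Sum>i<d. x i * \<xi> i) + t * L2_set \<xi> {..<d} - (x 0 + t)\<bar> \<le> 1"
proof -
  define y where "y = x(0 := x 0 + t)"
  have d0: "0 < d" using d by simp
  let ?N = "L2_set \<xi> {..<d}"
  have lin: "\<bar>\<Sum>i<d. y i * (\<xi> i - wave_centre i)\<bar> \<le> 1 / 2"
  proof (rule wave.linear_phase_le[OF \<xi>])
    fix i assume i: "i < d"
    show "\<bar>y i\<bar> * wave_width \<delta> i \<le> 1 / 2"
    proof (cases "i = 0")
      case True
      then show ?thesis using tubeD(1)[OF x i] by (simp add: y_def wave_width_def)
    next
      case False
      then show ?thesis using tubeD(2)[OF x i] \<delta> by (simp add: y_def wave_width_def field_simps)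
    qed
  qed simp
  have \<xi>0: "\<bar>\<xi> 0 - 1\<bar> \<le> 1 / 4"
    using wave.coord_le_of_cross_polytope[OF \<xi> d0] by (simp add: wave_centre_def wave_width_def)
  have N0: "\<xi> 0 \<le> ?N" using d0 by (intro member_le_L2_set) auto
  have "(\<Sum>i\<in>{1..<d}. \<bar>\<xi> i\<bar>) = (\<Sum>i\<in>{1..<d}. \<bar>\<xi> i - wave_centre i\<bar>)"
    by (intro sum.cong) (auto simp: wave_centre_def)
  also have "\<dots> \<le> \<delta>"
    using \<delta> by (intro wave.sum_abs_diff_le_of_cross_polytope[OF \<xi>]) (auto simp: wave_width_def)
  finally have "(\<Sum>i\<in>{1..<d}. (\<xi> i)\<^sup>2) \<le> \<delta>\<^sup>2"
    by (intro order_trans[OF sum_squares_le_square_sum_abs] power_mono sum_nonneg) auto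
  moreover have "?N\<^sup>2 = (\<xi> 0)\<^sup>2 + (\<Sum>i\<in>{1..<d}. (\<xi> i)\<^sup>2)"
    unfolding L2_set_def by (subst real_sqrt_pow2) (simp add: sum_nonneg, rule sum_lessThan_head[OF d0])
  ultimately have "(?N - \<xi> 0) * (?N + \<xi> 0) \<le> \<delta>\<^sup>2"
    by (simp add: power2_eq_square algebra_simps)
  moreover have "(?N - \<xi> 0) * 1 \<le> (?N - \<xi> 0) * (?N + \<xi> 0)"
    using N0 \<xi>0 by (intro mult_left_mono) linarith+
  ultimately have "\<bar>t * (?N - \<xi> 0)\<bar> \<le> 1 / 2"
    using N0 by (intro time_bound t) auto
  moreover have "(\<Sum>i<d. x i * \<xi> i) + t * ?N - (x 0 + t)
      = (\<Sum>i<d. y i * (\<xi> i - wave_centre i)) + t * (?N - \<xi> 0)"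
  proof -
    have "(\<Sum>i\<in>{1..<d}. y i * (\<xi> i - wave_centre i)) = (\<Sum>i\<in>{1..<d}. x i * \<xi> i)"
      by (intro sum.cong) (auto simp: y_def wave_centre_def)
    moreover have "y 0 * (\<xi> 0 - wave_centre 0) = (x 0 + t) * (\<xi> 0 - 1)"
      by (simp add: y_def wave_centre_def)
    ultimately show ?thesis
      unfolding sum_lessThan_head[OF d0] by (simp only:) (simp add: algebra_simps)
  qed
  ultimately show ?thesis using lin by linarith
qed

text \<open>Expanding \<open>\<bar>\<xi>\<bar>\<^sup>2\<close> around the centre \<open>a\<close> gives \<open>\<bar>a\<bar>\<^sup>2 - \<zeta>\<^sub>0 + \<bar>\<zeta>\<bar>\<^sup>2\<close> with \<open>\<zeta> = \<xi> - a\<close>. The linear term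
  shifts \<open>x\<^sub>0\<close> to \<open>x\<^sub>0 + t\<close>, as for the wave, and the quadratic term is harmless up to times of order
  \<open>1 / \<delta>\<^sup>2\<close>.\<close>

lemma schroedinger_phase:
  assumes t: "\<bar>t\<bar> \<le> 1 / (2 * \<delta>\<^sup>2)" and x: "x \<in> tube d \<delta> t"
    and \<xi>: "weighted_dist d schroedinger_centre (\<lambda>_. \<delta>) \<xi> \<le> 1"
  shows "\<bar>(\<Sum>i<d. x i * \<xi> i) + - t * (L2_set \<xi> {..<d})\<^sup>2 - (- x 0 / 2 - t / 4)\<bar> \<le> 1"
proof -
  define y where "y = x(0 := x 0 + t)"
  define \<zeta> where "\<zeta> i = \<xi> i - schroedinger_centre i" for i
  have d0: "0 < d" using d by simp
  have lin: "\<bar>\<Sum>i<d. y i * (\<xi> i - schroedinger_centre i)\<bar> \<le> 1 / 2"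
  proof (rule schroedinger.linear_phase_le[OF \<xi>])
    fix i assume i: "i < d"
    show "\<bar>y i\<bar> * \<delta> \<le> 1 / 2"
    proof (cases "i = 0")
      case True
      then have "\<bar>y i\<bar> * \<delta> \<le> 1 / 2 * 1"
        using tubeD(1)[OF x i] \<delta> by (intro mult_mono) (auto simp: y_def)
      then show ?thesis by simp
    next
      case False
      then show ?thesis using tubeD(2)[OF x i] \<delta> by (simp add: y_def field_simps)
    qed
  qed simp
  have "(\<Sum>i<d. \<bar>\<zeta> i\<bar>) \<le> \<delta>"
    unfolding \<zeta>_def using \<delta> by (intro schroedinger.sum_abs_diff_le_of_cross_polytope[OF \<xi>]) auto
  then have "(\<Sum>i<d. (\<zeta> i)\<^sup>2) \<le> \<delta>\<^sup>2"
    by (intro order_trans[OF sum_squares_le_square_sum_abs] power_mono sum_nonneg) auto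
  then have quad: "\<bar>t * (\<Sum>i<d. (\<zeta> i)\<^sup>2)\<bar> \<le> 1 / 2"
    by (intro time_bound t) (auto simp: sum_nonneg)
  have norm_sq: "(L2_set \<xi> {..<d})\<^sup>2 = (\<Sum>i<d. (\<xi> i)\<^sup>2)"
    unfolding L2_set_def by (subst real_sqrt_pow2) (auto intro: sum_nonneg)
  have "(\<Sum>i<d. x i * \<xi> i) + - t * (L2_set \<xi> {..<d})\<^sup>2 - (- x 0 / 2 - t / 4)
      = (\<Sum>i<d. y i * (\<xi> i - schroedinger_centre i)) - t * (\<Sum>i<d. (\<zeta> i)\<^sup>2)"
  proof -
    have "(\<Sum>i\<in>{1..<d}. y i * (\<xi> i - schroedinger_centre i)) = (\<Sum>i\<in>{1..<d}. x i * \<xi> i)"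
      "(\<Sum>i\<in>{1..<d}. (\<zeta> i)\<^sup>2) = (\<Sum>i\<in>{1..<d}. (\<xi> i)\<^sup>2)"
      by (intro sum.cong; auto simp: y_def \<zeta>_def schroedinger_centre_def)+
    moreover have "y 0 * (\<xi> 0 - schroedinger_centre 0) = (x 0 + t) * (\<xi> 0 + 1 / 2)"
      "(\<zeta> 0)\<^sup>2 = (\<xi> 0)\<^sup>2 + \<xi> 0 + 1 / 4"
      by (simp_all add: y_def \<zeta>_def schroedinger_centre_def power2_eq_square algebra_simps)
    ultimately show ?thesis
      unfolding norm_sq sum_lessThan_head[OF d0] by (simp only:) (simp add: algebra_simps)
  qed
  then show ?thesis using lin quad by linarith
qed

end

section \<open>Comparison of exponents\<close>

text \<open>Otherwise \<open>k \<le> B \<delta> powr (\<beta> - \<alpha>)\<close> tends to zero along \<open>\<delta> = 1 / n\<close>.\<close>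

lemma exponent_le_of_power_bound:
  fixes \<alpha> \<beta> k B :: real
  assumes k: "0 < k" and bound: "\<And>\<delta>. 0 < \<delta> \<Longrightarrow> \<delta> \<le> 1 / 4 \<Longrightarrow> k * \<delta> powr \<alpha> \<le> B * \<delta> powr \<beta>"
  shows "\<beta> \<le> \<alpha>"
proof (rule ccontr)
  assume "\<not> \<beta> \<le> \<alpha>"
  then have "(\<lambda>n. real n powr - (\<beta> - \<alpha>)) \<longlonglongrightarrow> 0"
    by (intro tendsto_neg_powr filterlim_real_sequentially) auto
  then have "(\<lambda>n. B * real n powr - (\<beta> - \<alpha>)) \<longlonglongrightarrow> B * 0"
    by (rule tendsto_mult_left)
  moreover have "k \<le> B * real n powr - (\<beta> - \<alpha>)" if n: "4 \<le> n" for n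
  proof -
    let ?\<delta> = "1 / real n"
    have \<delta>: "0 < ?\<delta>" "?\<delta> \<le> 1 / 4" using n by (auto simp: field_simps)
    have "?\<delta> powr \<beta> = ?\<delta> powr (\<beta> - \<alpha>) * ?\<delta> powr \<alpha>"
      by (simp flip: powr_add)
    with bound[OF \<delta>] have "k * ?\<delta> powr \<alpha> \<le> (B * ?\<delta> powr (\<beta> - \<alpha>)) * ?\<delta> powr \<alpha>"
      by (simp only: mult.assoc)
    moreover have "0 < ?\<delta> powr \<alpha>" using \<delta>(1) by (simp only: powr_gt_zero)
    ultimately have "k \<le> B * ?\<delta> powr (\<beta> - \<alpha>)"
      by (simp only: mult_le_cancel_right_pos)
    moreover have "?\<delta> powr (\<beta> - \<alpha>) = real n powr - (\<beta> - \<alpha>)"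
      unfolding powr_minus_divide using n by (simp add: powr_divide)
    ultimately show ?thesis by simp
  qed
  ultimately have "k \<le> B * 0"
    by (intro tendsto_lowerbound[where F=sequentially]) (auto intro: eventually_sequentiallyI)
  then show False using k by simp
qed

text \<open>The estimate evaluated on the two packets. The constant \<open>\<kappa>\<close> is the loss in \<open>inv_fourier_packet_ge\<close>
  relative to the product of the widths.\<close>

lemma scaling_bound:
  fixes q r :: ereal and d :: nat
  assumes d: "2 \<le> d" and qr: "1 \<le> q" "1 \<le> r" and A: "4 \<le> A" and C: "0 < C"
    and est: "\<forall>f \<in> L2 d. \<forall>g \<in> L2 d. \<forall>u v.
             fourier_supp_annulus d A f \<longrightarrow> fourier_supp_annulus d A g \<longrightarrow>
             wave_evolution d f u \<longrightarrow> schroedinger_evolution d g v \<longrightarrow>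
             mixed_norm d q r (\<lambda>t x. u t x * v t x) \<le> ennreal C * L2norm d f * L2norm d g"
    and \<delta>: "0 < \<delta>" "\<delta> \<le> 1 / 4"
  defines "\<kappa> \<equiv> 1 / (real d ^ d * (4 * (2 * pi) ^ d))"
  shows "\<kappa>\<^sup>2 / 4 * \<delta> powr (2 * real d - 1 - (real d - 1) * real_of_ereal (1 / r) - 2 * real_of_ereal (1 / q))
    \<le> C * 2 ^ d * \<delta> powr (real d - 1 / 2)"
proof -
  interpret wave: tent_box d wave_centre "wave_width \<delta>"
    by standard (use \<delta> in \<open>auto simp: wave_width_def\<close>)
  interpret schroedinger: tent_box d schroedinger_centre "\<lambda>_. \<delta>"
    by standard (use \<delta> in auto)
  have d0: "0 < d" using d by simp
  define f where "f = inv_fourier d (packet d wave_centre (wave_width \<delta>) (\<lambda>_. 0))"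
  define g where "g = inv_fourier d (packet d schroedinger_centre (\<lambda>_. \<delta>) (\<lambda>_. 0))"
  define u where "u t = inv_fourier d (packet d wave_centre (wave_width \<delta>) (\<lambda>\<xi>. t * L2_set \<xi> {..<d}))" for t
  define v where "v t = inv_fourier d (packet d schroedinger_centre (\<lambda>_. \<delta>) (\<lambda>\<xi>. - t * (L2_set \<xi> {..<d})\<^sup>2))" for t
  let ?\<rho> = "real_of_ereal (1 / r)" and ?\<sigma> = "real_of_ereal (1 / q)"
  \<comment> \<open>the product of the widths of the wave packet\<close>
  define P where "P = \<delta> ^ (d - 1) / 4"
  have P: "0 < P" using \<delta> by (simp add: P_def)
  have \<kappa>: "0 < \<kappa>" using d by (simp add: \<kappa>_def)
  have prod_wave: "(\<Prod>i<d. c * wave_width \<delta> i) = c ^ d * P" for c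
  proof -
    have "(\<Prod>i\<in>{1..<d}. wave_width \<delta> i) = \<delta> ^ (d - 1)"
      by (simp add: wave_width_def)
    then have "(\<Prod>i<d. wave_width \<delta> i) = P"
      unfolding prod_lessThan_head[OF d0] by (simp add: wave_width_def P_def)
    then show ?thesis by (simp add: prod.distrib)
  qed
  have "mixed_norm d q r (\<lambda>t x. u t x * v t x) \<le> ennreal C * L2norm d f * L2norm d g"
  proof -
    have "f \<in> L2 d" "g \<in> L2 d"
      unfolding f_def g_def by (rule wave.inv_fourier_packet_in_L2 schroedinger.inv_fourier_packet_in_L2)+
    moreover have "fourier_supp_annulus d A f"
      unfolding f_def by (rule wave.fourier_supp_annulus_packet[OF wave_in_annulus[OF d \<delta> A]])
    moreover have "fourier_supp_annulus d A g"
      unfolding g_def by (rule schroedinger.fourier_supp_annulus_packet[OF schroedinger_in_annulus[OF d \<delta> A]])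
    moreover have "wave_evolution d f u"
      unfolding f_def u_def[abs_def] by (rule wave.wave_evolution_packet)
    moreover have "schroedinger_evolution d g v"
      unfolding g_def v_def[abs_def] by (rule schroedinger.schroedinger_evolution_packet)
    ultimately show ?thesis using est by blast
  qed
  also have "\<dots> \<le> ennreal C * ennreal (sqrt (2 ^ d * P)) * ennreal (sqrt ((2 * \<delta>) ^ d))"
  proof (intro mult_mono order_refl)
    show "L2norm d f \<le> ennreal (sqrt (2 ^ d * P))"
      unfolding f_def using wave.L2norm_packet_le[of "\<lambda>_. 0"] by (simp add: prod_wave)
    show "L2norm d g \<le> ennreal (sqrt ((2 * \<delta>) ^ d))"
      unfolding g_def using schroedinger.L2norm_packet_le[of "\<lambda>_. 0"] by simp
  qed auto
  also have "\<dots> = ennreal (C * sqrt (2 ^ d * P) * sqrt ((2 * \<delta>) ^ d))"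
    using C P \<delta> by (simp add: ennreal_mult)
  finally have upper: "mixed_norm d q r (\<lambda>t x. u t x * v t x) \<le> ennreal (C * sqrt (2 ^ d * P) * sqrt ((2 * \<delta>) ^ d))" .
  let ?c = "\<kappa> * P * (\<kappa> * \<delta> ^ d)"
  have "ennreal (?c * ((1 / \<delta>) ^ (d - 1)) powr ?\<rho> * (2 * (1 / (2 * \<delta>\<^sup>2))) powr ?\<sigma>)
      \<le> mixed_norm d q r (\<lambda>t x. u t x * v t x)"
  proof (rule mixed_norm_ge[OF qr, where S="tube d \<delta>"])
    fix t :: real assume t: "\<bar>t\<bar> \<le> 1 / (2 * \<delta>\<^sup>2)"
    show "tube d \<delta> t \<in> sets (Leb d)" "emeasure (Leb d) (tube d \<delta> t) = ennreal ((1 / \<delta>) ^ (d - 1))"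
      by (rule tube_Leb[OF d0 \<delta>(1)])+
    fix x assume x: "x \<in> tube d \<delta> t"
    have "\<kappa> * P = (\<Prod>i<d. wave_width \<delta> i / real d) / (4 * (2 * pi) ^ d)"
      using prod_wave[of "1 / real d"] by (simp add: \<kappa>_def field_simps power_one_over)
    also have "\<dots> \<le> norm (u t x)"
      unfolding u_def by (rule wave.inv_fourier_packet_ge[OF d0 _ wave_phase[OF d \<delta> t x]]) auto
    finally have u: "\<kappa> * P \<le> norm (u t x)" .
    have "\<kappa> * \<delta> ^ d = (\<Prod>i<d. \<delta> / real d) / (4 * (2 * pi) ^ d)"
      by (simp add: \<kappa>_def power_divide)
    also have "\<dots> \<le> norm (v t x)"
      unfolding v_def by (rule schroedinger.inv_fourier_packet_ge[OF d0 _ schroedinger_phase[OF d \<delta> t x]]) auto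
    finally have "\<kappa> * \<delta> ^ d \<le> norm (v t x)" .
    with u show "?c \<le> norm (u t x * v t x)"
      unfolding norm_mult using \<kappa> \<delta> by (intro mult_mono) auto
  qed (use \<delta> P \<kappa> in auto)
  also note upper
  finally have main: "?c * ((1 / \<delta>) ^ (d - 1)) powr ?\<rho> * (2 * (1 / (2 * \<delta>\<^sup>2))) powr ?\<sigma>
      \<le> C * sqrt (2 ^ d * P) * sqrt ((2 * \<delta>) ^ d)"
    using C P \<delta> by (subst (asm) ennreal_le_iff) auto
  have pow: "\<delta> ^ (d - 1) = \<delta> powr (real d - 1)" "\<delta> ^ d = \<delta> powr real d"
    using \<delta> d powr_realpow[of \<delta> "d - 1"] powr_realpow[of \<delta> d] by (simp_all add: of_nat_diff)
  have e1: "?c = \<kappa>\<^sup>2 / 4 * \<delta> powr (2 * real d - 1)"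
  proof -
    have "?c = \<kappa>\<^sup>2 / 4 * (\<delta> powr (real d - 1) * \<delta> powr real d)"
      unfolding P_def pow by (simp add: power2_eq_square)
    then show ?thesis by (simp flip: powr_add)
  qed
  have e2: "((1 / \<delta>) ^ (d - 1)) powr ?\<rho> = \<delta> powr (- (real d - 1) * ?\<rho>)"
  proof -
    have "(1 / \<delta>) ^ (d - 1) = \<delta> powr - (real d - 1)"
      unfolding power_one_over pow powr_minus_divide ..
    then show ?thesis by (simp add: powr_powr)
  qed
  have e3: "(2 * (1 / (2 * \<delta>\<^sup>2))) powr ?\<sigma> = \<delta> powr (- 2 * ?\<sigma>)"
  proof -
    have "2 * (1 / (2 * \<delta>\<^sup>2)) = \<delta> powr - 2"
      unfolding powr_minus_divide using \<delta> by (simp add: powr_numeral)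
    then show ?thesis by (simp add: powr_powr)
  qed
  have e4: "sqrt (2 ^ d * P) * sqrt ((2 * \<delta>) ^ d) \<le> 2 ^ d * \<delta> powr (real d - 1 / 2)"
  proof -
    have "sqrt (2 ^ d * P) * sqrt ((2 * \<delta>) ^ d) \<le> sqrt (2 ^ d * \<delta> ^ (d - 1)) * sqrt ((2 * \<delta>) ^ d)"
      using \<delta> by (intro mult_right_mono real_sqrt_le_mono) (auto simp: P_def)
    also have "\<dots> = sqrt ((2 ^ d)\<^sup>2 * (\<delta> powr (real d - 1) * \<delta> powr real d))"
      unfolding power_mult_distrib pow by (simp add: power2_eq_square mult_ac flip: real_sqrt_mult)
    also have "\<dots> = sqrt ((2 ^ d)\<^sup>2) * sqrt (\<delta> powr (2 * real d - 1))"
      by (simp add: real_sqrt_mult flip: powr_add)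
    also have "sqrt (\<delta> powr (2 * real d - 1)) = \<delta> powr (real d - 1 / 2)"
      by (simp add: powr_half_sqrt[symmetric] powr_powr field_simps)
    finally show ?thesis by simp
  qed
  have "\<kappa>\<^sup>2 / 4 * \<delta> powr (2 * real d - 1 - (real d - 1) * ?\<rho> - 2 * ?\<sigma>)
      = \<kappa>\<^sup>2 / 4 * (\<delta> powr (2 * real d - 1) * \<delta> powr (- (real d - 1) * ?\<rho>) * \<delta> powr (- 2 * ?\<sigma>))"
    by (simp add: algebra_simps flip: powr_add)
  also have "\<dots> \<le> C * (sqrt (2 ^ d * P) * sqrt ((2 * \<delta>) ^ d))"
    using main unfolding e1 e2 e3 by (simp add: mult.assoc)
  also have "\<dots> \<le> C * (2 ^ d * \<delta> powr (real d - 1 / 2))"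
    using C e4 by (intro mult_left_mono) auto
  finally show ?thesis by (simp add: mult.assoc)
qed

lemma ereal_reciprocal_exponent:
  fixes p :: ereal
  assumes "1 \<le> p"
  obtains \<sigma> where "real_of_ereal (1 / p) = \<sigma>" "0 \<le> \<sigma>" "\<sigma> \<le> 1" "\<And>a::real. ereal a / p = ereal (a * \<sigma>)"
proof (cases p)
  case (real P)
  then have "1 \<le> P" using assms by simp
  then show ?thesis using that[of "1 / P"] by (simp add: real one_ereal_def)
next
  case PInf then show ?thesis using that[of 0] by simp
next
  case MInf then show ?thesis using assms by simp
qed

theorem theorem4:
  shows "\<exists>A\<^sub>0::real. A\<^sub>0 > 1 \<and>
    (\<forall>(d::nat) (q::ereal) (r::ereal) (A::real).
       d \<ge> 2 \<longrightarrow> 1 \<le> q \<longrightarrow> 1 \<le> r \<longrightarrow> A \<ge> A\<^sub>0 \<longrightarrow>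
       (\<exists>C::real. C > 0 \<and>
          (\<forall>f \<in> L2 d. \<forall>g \<in> L2 d. \<forall>u v.
             fourier_supp_annulus d A f \<longrightarrow> fourier_supp_annulus d A g \<longrightarrow>
             wave_evolution d f u \<longrightarrow> schroedinger_evolution d g v \<longrightarrow>
             mixed_norm d q r (\<lambda>t x. u t x * v t x) \<le> ennreal C * L2norm d f * L2norm d g)) \<longrightarrow>
       2 / q + ereal (real d - 1) / r \<le> ereal (real d - 1 / 2) \<and>
       1 / q \<le> ereal ((real d + 1) / 4))"
proof (intro exI[of _ 4] conjI allI impI)
  fix d :: nat and q r :: ereal and A :: real
  assume d: "2 \<le> d" and qr: "1 \<le> q" "1 \<le> r" and A: "4 \<le> A"
    and "\<exists>C::real. C > 0 \<and>
          (\<forall>f \<in> L2 d. \<forall>g \<in> L2 d. \<forall>u v.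
             fourier_supp_annulus d A f \<longrightarrow> fourier_supp_annulus d A g \<longrightarrow>
             wave_evolution d f u \<longrightarrow> schroedinger_evolution d g v \<longrightarrow>
             mixed_norm d q r (\<lambda>t x. u t x * v t x) \<le> ennreal C * L2norm d f * L2norm d g)"
  then obtain C :: real where C: "0 < C"
    and est: "\<forall>f \<in> L2 d. \<forall>g \<in> L2 d. \<forall>u v.
             fourier_supp_annulus d A f \<longrightarrow> fourier_supp_annulus d A g \<longrightarrow>
             wave_evolution d f u \<longrightarrow> schroedinger_evolution d g v \<longrightarrow>
             mixed_norm d q r (\<lambda>t x. u t x * v t x) \<le> ennreal C * L2norm d f * L2norm d g"
    by blast
  obtain \<sigma> where \<sigma>: "real_of_ereal (1 / q) = \<sigma>" "0 \<le> \<sigma>" "\<sigma> \<le> 1" "\<And>a::real. ereal a / q = ereal (a * \<sigma>)"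
    using ereal_reciprocal_exponent[OF qr(1)] by blast
  obtain \<rho> where \<rho>: "real_of_ereal (1 / r) = \<rho>" "0 \<le> \<rho>" "\<rho> \<le> 1" "\<And>a::real. ereal a / r = ereal (a * \<rho>)"
    using ereal_reciprocal_exponent[OF qr(2)] by blast
  have "real d - 1 / 2 \<le> 2 * real d - 1 - (real d - 1) * real_of_ereal (1 / r) - 2 * real_of_ereal (1 / q)"
    by (rule exponent_le_of_power_bound[OF _ scaling_bound[OF d qr A C est]]) (use d in auto)
  then have bound: "2 * \<sigma> + (real d - 1) * \<rho> \<le> real d - 1 / 2"
    unfolding \<sigma>(1) \<rho>(1) by simp
  have "2 / q = ereal (2 * \<sigma>)" "1 / q = ereal \<sigma>"
    using \<sigma>(4)[of 2] \<sigma>(4)[of 1] by (simp_all add: one_ereal_def)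
  moreover have "\<sigma> \<le> (real d + 1) / 4"
  proof (cases "d = 2")
    case True
    then show ?thesis using bound \<rho>(2) by simp
  next
    case False
    then have "3 \<le> real d" using d by simp
    then show ?thesis using \<sigma>(3) by simp
  qed
  ultimately show "2 / q + ereal (real d - 1) / r \<le> ereal (real d - 1 / 2)" "1 / q \<le> ereal ((real d + 1) / 4)"
    using bound by (simp_all add: \<rho>(4))
qed simp

end
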